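(* Let $m>1$ and $\ell\ge1$ be integers, $\mathcal{A}_\ell=\{0,1,\dots,m-1\}^\ell$, and let $q_1<\dots<q_\ell$ be functions as in the context with $q_1(k)=k$ for all $k$. Let $p=(p_\alpha,\ \alpha\in\mathcal{A}_\ell)$ be a probability vector and suppose that there exists a probability vector $r=(r_0,r_1,\dots,r_{m-1})$ such that $p_\alpha=\prod_{i=1}^\ell r_{\alpha_i}$ for any $\alpha=(\alpha_1,\dots,\alpha_\ell)\in\mathcal{A}_\ell$. Then the Hausdorff dimension of $$U_p=\Big\{x\in(0,1):\ \lim_{n\to\infty}\tfrac1nN_\alpha(x,n)=p_\alpha\ \text{ for all }\alpha\in\mathcal{A}_\ell\Big\}$$ is $$HD(U_p)=\frac{-\sum_{j=0}^{m-1}r_j\ln r_j}{\ln m},$$ with the convention $0\ln 0=0$.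
   Context: For $x\in[0,1)$ let $x=\sum_{i=1}^\infty a_{i-1}(x)m^{-i}$, $a_j(x)\in\{0,\dots,m-1\}$, $j=0,1,\dots$, be its base-$m$ expansion (tails consisting only of the digit $m-1$ are not allowed). For $\alpha\in\mathcal{A}_\ell$, $$N_\alpha(x,n)=\#\{k:\ 0<k\le n,\ (a_{q_1(k)}(x),\dots,a_{q_\ell(k)}(x))=\alpha\}.$$ The functions $q_1(n)<q_2(n)<\dots<q_\ell(n)$ are positive, take integer values on integers, and for some $\varepsilon\in(0,1]$ and all $n\ge1$ satisfy $q_i(n)\ge q_{i-1}(n)+\varepsilon n$ for $i=2,\dots,\ell$ and $q_i(n+1)\ge q_i(n)+\varepsilon$ for $i=1,\dots,\ell$. A probability vector is a vector of nonnegative numbers summing to 1. $HD$ denotes Hausdorff dimension. *)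

theory Defs
  imports "HOL-Analysis.Analysis"
begin

section \<open>Hausdorff measure and dimension\<close>

text \<open>\<open>|A|\<^sup>s\<close> with the conventions \<open>|{}|\<^sup>s = 0\<close>, and \<open>|A|\<^sup>0 = 1\<close> for \<open>A \<noteq> {}\<close> (so that
  \<open>s = 0\<close> gives counting measure; note that \<open>0 powr 0 = 0\<close>).\<close>

definition hausdorff_gauge :: "real \<Rightarrow> 'a::metric_space set \<Rightarrow> ennreal" where
  "hausdorff_gauge s A =
     (if A = {} then 0 else if s = 0 then 1 else ennreal (diameter A powr s))"

text \<open>Boundedness is required explicitly because \<^const>\<open>diameter\<close> is only meaningful on bounded
  sets. Finite covers are included, as the covering sets may be empty.\<close>

definition delta_covers :: "real \<Rightarrow> 'a::metric_space set \<Rightarrow> (nat \<Rightarrow> 'a set) set" where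
  "delta_covers \<delta> E = {U. E \<subseteq> (\<Union>i. U i) \<and> (\<forall>i. bounded (U i) \<and> diameter (U i) \<le> \<delta>)}"

definition hausdorff_premeasure :: "real \<Rightarrow> real \<Rightarrow> 'a::metric_space set \<Rightarrow> ennreal" where
  "hausdorff_premeasure \<delta> s E = (INF U\<in>delta_covers \<delta> E. \<Sum>i. hausdorff_gauge s (U i))"

definition hausdorff_measure :: "real \<Rightarrow> 'a::metric_space set \<Rightarrow> ennreal" where
  "hausdorff_measure s E = (SUP \<delta>\<in>{0<..}. hausdorff_premeasure \<delta> s E)"

definition hausdorff_dim :: "'a::metric_space set \<Rightarrow> ennreal" where
  "hausdorff_dim E = Inf {ennreal s | s. 0 \<le> s \<and> hausdorff_measure s E = 0}"


section \<open>Base-\<open>m\<close> expansions\<close>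

definition is_base_expansion :: "nat \<Rightarrow> real \<Rightarrow> (nat \<Rightarrow> nat) \<Rightarrow> bool" where
  "is_base_expansion m x a \<longleftrightarrow>
     (\<forall>j. a j \<in> {0..m - 1}) \<and>
     (\<lambda>j. real (a j) / real m ^ Suc j) sums x \<and>
     \<not> (\<exists>N. \<forall>j\<ge>N. a j = m - 1)"

definition base_digit :: "nat \<Rightarrow> real \<Rightarrow> nat \<Rightarrow> nat" where
  "base_digit m x = (THE a. is_base_expansion m x a)"

lemma base_expansion_partial_sum:
  fixes m :: nat
  assumes m: "m > 1" and a: "is_base_expansion m x a"
  shows "of_int \<lfloor>real m ^ n * x\<rfloor> = real m ^ n * (\<Sum>j<n. real (a j) / real m ^ Suc j)"
proof -
  let ?M = "real m"
  let ?f = "\<lambda>j. real (a j) / ?M ^ Suc j"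
  have M: "?M > 1" using m by simp
  have sf: "?f sums x" using a by (simp add: is_base_expansion_def)
  have "summable ?f" using sf by (rule sums_summable)
  then have sft: "summable (\<lambda>j. ?f (j + n))" by (rule summable_ignore_initial_segment)
  define t where "t = (\<Sum>j. ?f (j + n))"
  have x: "x = t + (\<Sum>j<n. ?f j)"
    unfolding t_def using suminf_split_initial_segment[OF \<open>summable ?f\<close>] sums_unique[OF sf] by simp
  have t0: "t \<ge> 0" unfolding t_def by (rule suminf_nonneg[OF sft]) simp
  let ?g = "\<lambda>j. (?M - 1) / ?M ^ Suc n * (1 / ?M) ^ j"
  have gs: "?g sums ((?M - 1) / ?M ^ Suc n * (1 / (1 - 1 / ?M)))"
    using M by (intro sums_mult geometric_sums) auto
  have val: "(?M - 1) / ?M ^ Suc n * (1 / (1 - 1 / ?M)) = 1 / ?M ^ n"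
    using M by (simp add: field_simps)
  have d: "(\<lambda>j. ?g j - ?f (j + n)) sums (1 / ?M ^ n - t)"
    using sums_diff[OF gs summable_sums[OF sft]] unfolding val t_def .
  have de: "?g j - ?f (j + n) = (?M - 1 - real (a (j + n))) / ?M ^ Suc (j + n)" for j
    using M by (simp add: field_simps power_add)
  have le: "real (a j) \<le> ?M - 1" for j
  proof -
    have "a j \<le> m - 1" using a by (simp add: is_base_expansion_def)
    then show ?thesis using m by linarith
  qed
  obtain k where k: "k \<ge> n" "a k \<noteq> m - 1"
    using a unfolding is_base_expansion_def by blast
  have "real (a k) < ?M - 1"
  proof -
    have "a k \<le> m - 1" using a by (simp add: is_base_expansion_def)
    then show ?thesis using k m by linarith
  qed
  then have "0 < ?g (k - n) - ?f (k - n + n)" unfolding de using k M by simp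
  moreover have "0 \<le> ?g j - ?f (j + n)" for j unfolding de using le M by simp
  ultimately have "0 < (\<Sum>j. ?g j - ?f (j + n))"
    using suminf_pos2[OF sums_summable[OF d]] by blast
  then have t1: "t < 1 / ?M ^ n" using sums_unique[OF d] by simp
  define S where "S = (\<Sum>j<n. int (a j) * int m ^ (n - Suc j))"
  have S: "of_int S = ?M ^ n * (\<Sum>j<n. ?f j)"
    unfolding S_def sum_distrib_left of_int_sum
  proof (rule sum.cong[OF refl])
    fix j assume "j \<in> {..<n}"
    then have "?M ^ n = ?M ^ Suc j * ?M ^ (n - Suc j)"
      by (metis Suc_leI lessThan_iff le_add_diff_inverse power_add)
    then show "of_int (int (a j) * int m ^ (n - Suc j)) = ?M ^ n * ?f j"
      using M by simp
  qed
  have "?M ^ n * x = of_int S + ?M ^ n * t" unfolding S x by (simp add: algebra_simps)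
  moreover have "0 \<le> ?M ^ n * t" "?M ^ n * t < 1" using t0 t1 M by (simp_all add: field_simps)
  ultimately have "\<lfloor>?M ^ n * x\<rfloor> = S" by (simp add: floor_unique)
  then show ?thesis using S by simp
qed

lemma base_expansion_digit:
  fixes m :: nat
  assumes m: "m > 1" and a: "is_base_expansion m x a"
  shows "int (a j) = \<lfloor>real m ^ Suc j * x\<rfloor> - int m * \<lfloor>real m ^ j * x\<rfloor>"
proof -
  have "real_of_int (int (a j)) =
      of_int (\<lfloor>real m ^ Suc j * x\<rfloor> - int m * \<lfloor>real m ^ j * x\<rfloor>)"
    unfolding of_int_diff of_int_mult base_expansion_partial_sum[OF m a]
    using m by (simp add: algebra_simps)
  then show ?thesis by (simp only: of_int_eq_iff)
qed

lemma base_expansion_exists: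
  fixes m :: nat
  assumes m: "m > 1" and x: "0 \<le> x" "x < 1"
  shows "\<exists>a. is_base_expansion m x a"
proof -
  let ?M = "real m"
  have M: "?M > 1" using m by simp
  define F where "F n = \<lfloor>?M ^ n * x\<rfloor>" for n
  define a where "a j = nat (F (Suc j) - int m * F j)" for j
  have lo: "int m * F j \<le> F (Suc j)" for j
    unfolding F_def le_floor_iff using M by (simp add: mult.assoc)
  have hi: "F (Suc j) < int m * F j + int m" for j
  proof -
    have "?M ^ j * x < of_int (F j) + 1" unfolding F_def by linarith
    then have "?M * (?M ^ j * x) < ?M * (of_int (F j) + 1)" using M by simp
    then show ?thesis unfolding F_def floor_less_iff by (simp add: algebra_simps)
  qed
  have ai: "real (a j) = of_int (F (Suc j)) - ?M * of_int (F j)" for j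
    unfolding a_def using lo[of j] by simp
  have F0: "F 0 = 0" unfolding F_def using x by (simp add: floor_eq_iff)
  have ps: "(\<Sum>j<n. real (a j) / ?M ^ Suc j) = of_int (F n) / ?M ^ n" for n
  proof (induction n)
    case (Suc n)
    then show ?case using M by (simp add: ai field_simps)
  qed (simp add: F0)
  have lim: "(\<lambda>n. of_int (F n) / ?M ^ n) \<longlonglongrightarrow> x"
  proof (rule tendsto_sandwich)
    show "\<forall>\<^sub>F n in sequentially. x - (1 / ?M) ^ n \<le> of_int (F n) / ?M ^ n"
    proof (rule always_eventually, rule allI)
      fix n
      have "?M ^ n * x < of_int (F n) + 1" unfolding F_def by linarith
      then have "x \<le> (of_int (F n) + 1) / ?M ^ n"
        using M by (simp add: pos_le_divide_eq mult.commute)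
      then show "x - (1 / ?M) ^ n \<le> of_int (F n) / ?M ^ n"
        by (simp add: add_divide_distrib power_one_over)
    qed
    show "\<forall>\<^sub>F n in sequentially. of_int (F n) / ?M ^ n \<le> x"
    proof (rule always_eventually, rule allI)
      fix n
      have "of_int (F n) \<le> ?M ^ n * x" unfolding F_def by linarith
      then show "of_int (F n) / ?M ^ n \<le> x" using M by (simp add: field_simps)
    qed
    have "(\<lambda>n. (1 / ?M) ^ n) \<longlonglongrightarrow> 0" using M by (intro LIMSEQ_power_zero) simp
    then show "(\<lambda>n. x - (1 / ?M) ^ n) \<longlonglongrightarrow> x" by (auto intro: tendsto_eq_intros)
  qed simp
  have sums: "(\<lambda>j. real (a j) / ?M ^ Suc j) sums x"
    unfolding sums_def ps by (rule lim)
  have tail: False if "\<forall>j\<ge>N. a j = m - 1" for N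
  proof -
    have step: "(of_int (F j) + 1) / ?M ^ j = (of_int (F N) + 1) / ?M ^ N" if "j \<ge> N" for j
      using that
    proof (induction j rule: dec_induct)
      case (step j)
      have "real (a j) = ?M - 1" using \<open>\<forall>j\<ge>N. a j = m - 1\<close> step(1) m by simp
      then have "of_int (F (Suc j)) + 1 = ?M * (of_int (F j) + 1)"
        using ai[of j] by (simp add: algebra_simps)
      then have "(of_int (F (Suc j)) + 1) / ?M ^ Suc j = (of_int (F j) + 1) / ?M ^ j"
        using M by simp
      then show ?case using step.IH by simp
    qed simp
    have "(\<lambda>n. of_int (F n) / ?M ^ n + (1 / ?M) ^ n) \<longlonglongrightarrow> x + 0"
      using M by (intro tendsto_add lim LIMSEQ_power_zero) simp
    then have "(\<lambda>n. (of_int (F n) + 1) / ?M ^ n) \<longlonglongrightarrow> x"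
      by (simp add: add_divide_distrib power_divide)
    moreover have "(\<lambda>n. (of_int (F n) + 1) / ?M ^ n) \<longlonglongrightarrow> (of_int (F N) + 1) / ?M ^ N"
      by (intro tendsto_eventually eventually_sequentiallyI[of N] step)
    ultimately have "x = (of_int (F N) + 1) / ?M ^ N" by (rule LIMSEQ_unique)
    then have "?M ^ N * x = of_int (F N) + 1" using M by simp
    then show False unfolding F_def by linarith
  qed
  have "a j \<le> m - 1" for j unfolding a_def using hi[of j] m by linarith
  then have "is_base_expansion m x a"
    unfolding is_base_expansion_def using sums tail by auto
  then show ?thesis by blast
qed

lemma base_expansion_ex1:
  fixes m :: nat
  assumes "m > 1" "0 \<le> x" "x < 1"
  shows "\<exists>!a. is_base_expansion m x a"
proof (rule ex_ex1I)
  show "\<exists>a. is_base_expansion m x a" using base_expansion_exists assms by blast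
  fix a b assume "is_base_expansion m x a" "is_base_expansion m x b"
  then have "int (a j) = int (b j)" for j by (simp only: base_expansion_digit[OF assms(1)])
  then show "a = b" by auto
qed

lemma is_base_expansion_base_digit:
  fixes m :: nat
  assumes "m > 1" "0 \<le> x" "x < 1"
  shows "is_base_expansion m x (base_digit m x)"
  unfolding base_digit_def by (rule theI'[OF base_expansion_ex1[OF assms]])


section \<open>Nonconventional digit frequencies\<close>

text \<open>Only the values of \<open>q\<^sub>i\<close> (\<open>1 \<le> i \<le> \<ell>\<close>) at the positive integers matter.\<close>

definition admissible_times :: "nat \<Rightarrow> (nat \<Rightarrow> nat \<Rightarrow> nat) \<Rightarrow> bool" where
  "admissible_times l q \<longleftrightarrow>
     (\<forall>n\<ge>1. \<forall>i\<in>{1..l}. q i n > 0) \<and>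
     (\<forall>n\<ge>1. \<forall>i\<in>{2..l}. q (i - 1) n < q i n) \<and>
     (\<exists>\<epsilon>::real. 0 < \<epsilon> \<and> \<epsilon> \<le> 1 \<and>
        (\<forall>n\<ge>1. \<forall>i\<in>{2..l}. real (q i n) \<ge> real (q (i - 1) n) + \<epsilon> * real n) \<and>
        (\<forall>n\<ge>1. \<forall>i\<in>{1..l}. real (q i (n + 1)) \<ge> real (q i n) + \<epsilon>))"

definition prob_vector :: "'i set \<Rightarrow> ('i \<Rightarrow> real) \<Rightarrow> bool" where
  "prob_vector I p \<longleftrightarrow> (\<forall>i\<in>I. p i \<ge> 0) \<and> (\<Sum>i\<in>I. p i) = 1"

text \<open>A word \<open>(\<alpha>\<^sub>1, \<dots>, \<alpha>\<^sub>\<ell>)\<close> is an extensional function on \<open>{1..\<ell>}\<close>.\<close>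

definition words :: "nat \<Rightarrow> nat \<Rightarrow> (nat \<Rightarrow> nat) set" where
  "words m l = {1..l} \<rightarrow>\<^sub>E {0..m - 1}"

definition word_count ::
    "nat \<Rightarrow> nat \<Rightarrow> (nat \<Rightarrow> nat \<Rightarrow> nat) \<Rightarrow> (nat \<Rightarrow> nat) \<Rightarrow> real \<Rightarrow> nat \<Rightarrow> nat" where
  "word_count m l q \<alpha> x n =
     card {k. 0 < k \<and> k \<le> n \<and> (\<lambda>i\<in>{1..l}. base_digit m x (q i k)) = \<alpha>}"

definition frequency_set ::
    "nat \<Rightarrow> nat \<Rightarrow> (nat \<Rightarrow> nat \<Rightarrow> nat) \<Rightarrow> ((nat \<Rightarrow> nat) \<Rightarrow> real) \<Rightarrow> real set" where
  "frequency_set m l q p =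
     {x \<in> {0<..<1}. \<forall>\<alpha>\<in>words m l.
        (\<lambda>n. 1 / real n * real (word_count m l q \<alpha> x n)) \<longlonglongrightarrow> p \<alpha>}"

end

theory Submission
  imports Defs "HOL-Probability.Probability" "HOL-Library.Discrete_Functions"
begin

text \<open>For the upper bound only the single-digit frequencies matter: since \<open>q\<^sub>1(k) = k\<close>, every function \<open>g\<close>
  of one digit has Birkhoff averages converging to \<open>\<Sum>\<^sub>j r\<^sub>j g(j)\<close> on \<open>U\<^sub>p\<close>. With \<open>g = ln (r + t)\<close>, the small
  shift \<open>t\<close> making the weights positive, long prefixes of points of \<open>U\<^sub>p\<close> have weight at least
  \<open>exp (- n (H + \<eta>))\<close>, and there are at most about \<open>exp (n H)\<close> such words.

  For the lower bound choose the digits independently with law \<open>r\<close>. The events ``the word read at time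
  \<open>k\<close> is \<open>\<alpha>\<close>'' have probability \<open>p\<^sub>\<alpha>\<close>, and each of them is correlated with at most \<open>\<ell>\<^sup>2\<close> others, because
  every \<open>q\<^sub>i\<close> is injective. So the variance of the count up to \<open>n\<close> is \<open>O(n)\<close>; this gives almost sure
  convergence of the frequencies along squares, hence along all \<open>n\<close> by monotonicity. The law of the
  random point is thus carried by \<open>U\<^sub>p\<close>, where the \<open>n\<close>-th cylinder has mass \<open>exp (- n (H + o(1)))\<close> or
  mass zero, and the mass distribution principle applies.\<close>

section \<open>Digit averages along typical sequences\<close>

text \<open>Formulated for digit sequences instead of points, so that the same condition serves for
  \<open>base_digit m x\<close> in the upper bound and for a random sequence in the lower
  bound.\<close>

definition typical_seq ::
    "nat \<Rightarrow> nat \<Rightarrow> (nat \<Rightarrow> nat \<Rightarrow> nat) \<Rightarrow> ((nat \<Rightarrow> nat) \<Rightarrow> real) \<Rightarrow> (nat \<Rightarrow> nat) \<Rightarrow> bool" where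
  "typical_seq m l q p a \<longleftrightarrow>
     (\<forall>\<alpha>\<in>words m l. (\<lambda>n. 1 / real n *
        real (card {k. 0 < k \<and> k \<le> n \<and> (\<lambda>i\<in>{1..l}. a (q i k)) = \<alpha>})) \<longlonglongrightarrow> p \<alpha>)"

lemma frequency_set_eq:
  "frequency_set m l q p = {x \<in> {0<..<1}. typical_seq m l q p (base_digit m x)}"
  by (simp add: frequency_set_def typical_seq_def word_count_def)

lemma finite_words: "finite (words m l)"
  unfolding words_def by (intro finite_PiE) auto

text \<open>Under the product weights the letters are independent with law \<open>r\<close>, so the
  first letter has law \<open>r\<close> and the sums over the other letters are 1.\<close>

lemma sum_words_first_letter:
  fixes g r :: "nat \<Rightarrow> real"
  assumes "l \<ge> 1" and r: "(\<Sum>j = 0..m - 1. r j) = 1"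
  shows "(\<Sum>\<alpha>\<in>words m l. (\<Prod>i = 1..l. r (\<alpha> i)) * g (\<alpha> 1)) = (\<Sum>j = 0..m - 1. r j * g j)"
proof -
  \<comment> \<open>Absorbing \<open>g\<close> into the first factor makes each summand a pure
    product over the positions, and the sum over words becomes a product of sums.\<close>
  define f where "f i j = r j * (if i = 1 then g j else 1)" for i j :: nat
  have I: "{1..l} = insert 1 {2..l}" using assms(1) by auto
  have "(\<Sum>\<alpha>\<in>words m l. (\<Prod>i = 1..l. r (\<alpha> i)) * g (\<alpha> 1))
      = (\<Sum>\<alpha>\<in>words m l. \<Prod>i = 1..l. f i (\<alpha> i))"
  proof (rule sum.cong[OF refl])
    fix \<alpha>
    have "(\<Prod>i = 2..l. f i (\<alpha> i)) = (\<Prod>i = 2..l. r (\<alpha> i))"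
      by (rule prod.cong) (auto simp: f_def)
    then show "(\<Prod>i = 1..l. r (\<alpha> i)) * g (\<alpha> 1) = (\<Prod>i = 1..l. f i (\<alpha> i))"
      unfolding I by (simp add: f_def)
  qed
  also have "\<dots> = (\<Prod>i = 1..l. \<Sum>j = 0..m - 1. f i j)"
    unfolding words_def by (rule prod_sum_PiE[symmetric]) auto
  also have "(\<Prod>i = 2..l. \<Sum>j = 0..m - 1. f i j) = 1"
    using r by (intro prod.neutral) (auto simp: f_def)
  then have "(\<Prod>i = 1..l. \<Sum>j = 0..m - 1. f i j) = (\<Sum>j = 0..m - 1. r j * g j)"
    unfolding I by (simp add: f_def)
  finally show ?thesis .
qed

text \<open>As \<open>q 1 k = k\<close>, the first letter of the word read at time \<open>k\<close>
  is \<open>a k\<close>. Grouping the times by the word read there turns the sum of \<open>g\<close>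
  into a linear combination of word counts.\<close>

lemma typical_seq_average:
  fixes g r :: "nat \<Rightarrow> real"
  assumes l: "l \<ge> 1" and q1: "\<And>k. k \<ge> 1 \<Longrightarrow> q 1 k = k"
    and r: "(\<Sum>j = 0..m - 1. r j) = 1"
    and p: "\<And>\<alpha>. \<alpha> \<in> words m l \<Longrightarrow> p \<alpha> = (\<Prod>i = 1..l. r (\<alpha> i))"
    and a: "\<And>j. a j \<in> {0..m - 1}" and typical: "typical_seq m l q p a"
  shows "(\<lambda>n. (\<Sum>k<n. g (a k)) / real n) \<longlonglongrightarrow> (\<Sum>j = 0..m - 1. r j * g j)"
proof -
  define w where "w k = (\<lambda>i\<in>{1..l}. a (q i k))" for k
  define c where "c \<alpha> n = real (card {k. 0 < k \<and> k \<le> n \<and> w k = \<alpha>})" for \<alpha> n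
  have w: "w k \<in> words m l" for k
    using a by (auto simp: w_def words_def)
  have sum: "(\<Sum>k\<in>{1..n}. g (a k)) = (\<Sum>\<alpha>\<in>words m l. c \<alpha> n * g (\<alpha> 1))" for n
  proof -
    have "(\<Sum>k\<in>{1..n}. g (a k)) = (\<Sum>\<alpha>\<in>words m l. \<Sum>k\<in>{k\<in>{1..n}. w k = \<alpha>}. g (a k))"
      using w by (intro sum.group[symmetric] finite_words) auto
    also have "\<dots> = (\<Sum>\<alpha>\<in>words m l. c \<alpha> n * g (\<alpha> 1))"
    proof (rule sum.cong[OF refl])
      fix \<alpha>
      have "(\<Sum>k\<in>{k\<in>{1..n}. w k = \<alpha>}. g (a k)) = (\<Sum>k\<in>{k\<in>{1..n}. w k = \<alpha>}. g (\<alpha> 1))"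
        using l q1 by (intro sum.cong) (auto simp: w_def)
      also have "\<dots> = real (card {k\<in>{1..n}. w k = \<alpha>}) * g (\<alpha> 1)" by simp
      also have "\<dots> = c \<alpha> n * g (\<alpha> 1)" by (simp add: c_def Suc_le_eq)
      finally show "(\<Sum>k\<in>{k\<in>{1..n}. w k = \<alpha>}. g (a k)) = c \<alpha> n * g (\<alpha> 1)" .
    qed
    finally show ?thesis .
  qed
  have "(\<lambda>n. \<Sum>\<alpha>\<in>words m l. (1 / real n * c \<alpha> n) * g (\<alpha> 1)) \<longlonglongrightarrow> (\<Sum>\<alpha>\<in>words m l. p \<alpha> * g (\<alpha> 1))"
    using typical unfolding typical_seq_def c_def w_def by (intro tendsto_sum tendsto_mult_right) auto
  also have "(\<Sum>\<alpha>\<in>words m l. p \<alpha> * g (\<alpha> 1)) = (\<Sum>j = 0..m - 1. r j * g j)"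
    using sum_words_first_letter[OF l r, of g] by (simp add: p)
  also have "(\<lambda>n. \<Sum>\<alpha>\<in>words m l. (1 / real n * c \<alpha> n) * g (\<alpha> 1)) = (\<lambda>n. (\<Sum>k\<in>{1..n}. g (a k)) / real n)"
    unfolding sum by (simp add: sum_divide_distrib fun_eq_iff)
  finally have 1: "(\<lambda>n. (\<Sum>k\<in>{1..n}. g (a k)) / real n) \<longlonglongrightarrow> (\<Sum>j = 0..m - 1. r j * g j)" .
  \<comment> \<open>The word counts use the digits with indices 1 to \<open>n\<close>, the claim
    those from 0 to \<open>n - 1\<close>. Adding digit 0 and dividing by \<open>Suc n\<close>
    changes nothing in the limit.\<close>
  have 2: "(\<lambda>n. real n / real (Suc n)) \<longlonglongrightarrow> 1"
    by (rule LIMSEQ_n_over_Suc_n)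
  have 3: "(\<lambda>n. g (a 0) / real (Suc n)) \<longlonglongrightarrow> 0"
    by (rule LIMSEQ_Suc) (rule lim_const_over_n)
  have "(\<lambda>n. g (a 0) / real (Suc n) + (\<Sum>k\<in>{1..n}. g (a k)) / real n * (real n / real (Suc n)))
      \<longlonglongrightarrow> 0 + (\<Sum>j = 0..m - 1. r j * g j) * 1"
    by (intro tendsto_intros 1 2 3)
  also have "(\<lambda>n. g (a 0) / real (Suc n) + (\<Sum>k\<in>{1..n}. g (a k)) / real n * (real n / real (Suc n)))
      = (\<lambda>n. (\<Sum>k<Suc n. g (a k)) / real (Suc n))"
  proof
    fix n
    have "{..<Suc n} = insert 0 {1..n}" by auto
    then have "(\<Sum>k<Suc n. g (a k)) = g (a 0) + (\<Sum>k\<in>{1..n}. g (a k))" by simp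
    then show "g (a 0) / real (Suc n) + (\<Sum>k\<in>{1..n}. g (a k)) / real n * (real n / real (Suc n))
      = (\<Sum>k<Suc n. g (a k)) / real (Suc n)"
      by (cases "n = 0") (simp_all add: add_divide_distrib)
  qed
  finally have "(\<lambda>n. (\<Sum>k<Suc n. g (a k)) / real (Suc n)) \<longlonglongrightarrow> (\<Sum>j = 0..m - 1. r j * g j)"
    by simp
  then show ?thesis by (rule LIMSEQ_imp_Suc)
qed

section \<open>Entropy of a probability vector and its effect on typical sequences\<close>

lemma entropy_eq_0_of_point_mass:
  fixes r :: "'i \<Rightarrow> real"
  assumes "finite I" "prob_vector I r" "i \<in> I" "r i = 1"
  shows "(\<Sum>j\<in>I. r j * ln (r j)) = 0"
proof -
  have "(\<Sum>j\<in>I - {i}. r j) = 0"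
    using assms by (simp add: prob_vector_def sum_diff1)
  then have "\<forall>j\<in>I - {i}. r j = 0"
    using assms by (subst (asm) sum_nonneg_eq_0_iff) (auto simp: prob_vector_def)
  then show ?thesis using assms(4) by (intro sum.neutral) fastforce
qed

lemma prob_vector_le_1:
  fixes r :: "'i \<Rightarrow> real"
  assumes "finite I" "prob_vector I r" "i \<in> I"
  shows "r i \<le> 1"
  using member_le_sum[of i I r] assms by (auto simp: prob_vector_def)

lemma entropy_nonneg:
  fixes r :: "'i \<Rightarrow> real"
  assumes "finite I" "prob_vector I r"
  shows "- (\<Sum>j\<in>I. r j * ln (r j)) \<ge> 0"
proof -
  have "r j * ln (r j) \<le> 0" if "j \<in> I" for j
  proof (cases "r j = 0")
    case False
    then have "0 < r j" using assms(2) that by (force simp: prob_vector_def)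
    then show ?thesis
      using prob_vector_le_1[OF assms that] by (intro mult_nonneg_nonpos) auto
  qed simp
  then have "(\<Sum>j\<in>I. r j * ln (r j)) \<le> 0" by (rule sum_nonpos)
  then show ?thesis by simp
qed

text \<open>The digits other than \<open>c\<close> have limiting frequency \<open>1 - r c\<close>,
  which is nonzero; they would have frequency 0 if the sequence ended in \<open>c\<close> only. With
  \<open>c = m - 1\<close> this makes a typical sequence a legitimate expansion, with
  \<open>c = 0\<close> it keeps the point away from 0.\<close>

lemma typical_seq_not_eventually_const:
  fixes r :: "nat \<Rightarrow> real"
  assumes l: "l \<ge> 1" and q1: "\<And>k. k \<ge> 1 \<Longrightarrow> q 1 k = k"
    and r: "(\<Sum>j = 0..m - 1. r j) = 1"
    and p: "\<And>\<alpha>. \<alpha> \<in> words m l \<Longrightarrow> p \<alpha> = (\<Prod>i = 1..l. r (\<alpha> i))"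
    and a: "\<And>j. a j \<in> {0..m - 1}" and typical: "typical_seq m l q p a"
    and c: "c \<in> {0..m - 1}" "r c \<noteq> 1"
  shows "\<not> (\<exists>N. \<forall>j\<ge>N. a j = c)"
proof
  assume "\<exists>N. \<forall>j\<ge>N. a j = c"
  then obtain N where N: "\<And>j. j \<ge> N \<Longrightarrow> a j = c" by blast
  define g :: "nat \<Rightarrow> real" where "g j = (if j = c then 0 else 1)" for j
  have "(\<lambda>n. (\<Sum>k<n. g (a k)) / real n) \<longlonglongrightarrow> (\<Sum>j = 0..m - 1. r j * g j)"
    by (rule typical_seq_average[OF l q1 r p a typical])
  moreover have "(\<Sum>j = 0..m - 1. r j * g j) = 1 - r c"
  proof -
    have "(\<Sum>j = 0..m - 1. r j * g j) = (\<Sum>j\<in>{0..m - 1} - {c}. r j)"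
      using c(1) by (subst sum.remove[of _ c]) (auto simp: g_def intro!: sum.cong)
    then show ?thesis using c(1) r by (simp add: sum_diff1)
  qed
  moreover have "(\<lambda>n. (\<Sum>k<n. g (a k)) / real n) \<longlonglongrightarrow> 0"
  proof (rule Lim_transform_eventually)
    show "(\<lambda>n. (\<Sum>k<N. g (a k)) / real n) \<longlonglongrightarrow> 0" by (rule lim_const_over_n)
    show "\<forall>\<^sub>F n in sequentially. (\<Sum>k<N. g (a k)) / real n = (\<Sum>k<n. g (a k)) / real n"
      using eventually_ge_at_top[of N]
    proof eventually_elim
      case (elim n)
      have "(\<Sum>k<n. g (a k)) = (\<Sum>k<N. g (a k))"
        using elim N by (intro sum.mono_neutral_right) (auto simp: g_def)
      then show ?case by simp
    qed
  qed
  ultimately have "1 - r c = 0" using LIMSEQ_unique by fastforce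
  then show False using c(2) by simp
qed

text \<open>The product is the mass of the cylinder given by the first \<open>n\<close> digits. Its
  logarithm divided by \<open>n\<close> tends to minus the entropy, by the average of
  \<open>ln\<close> of the weights.\<close>

lemma typical_seq_prod_decay:
  fixes r :: "nat \<Rightarrow> real"
  assumes m: "m > 1" and l: "l \<ge> 1" and q1: "\<And>k. k \<ge> 1 \<Longrightarrow> q 1 k = k"
    and r: "prob_vector {0..m - 1} r"
    and p: "\<And>\<alpha>. \<alpha> \<in> words m l \<Longrightarrow> p \<alpha> = (\<Prod>i = 1..l. r (\<alpha> i))"
    and a: "\<And>j. a j \<in> {0..m - 1}" and typical: "typical_seq m l q p a"
    and s: "s * ln (real m) < - (\<Sum>j = 0..m - 1. r j * ln (r j))"
  shows "\<forall>\<^sub>F n in sequentially. (\<Prod>k<n. r (a k)) \<le> ((1 / real m) ^ n) powr s"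
proof (cases "\<exists>k. r (a k) = 0")
  \<comment> \<open>Since \<open>ln 0 = 0\<close> in HOL, logarithms cannot see a digit of weight
    zero. Once such a digit has occurred, the product is 0.\<close>
  case True
  then obtain k where k: "r (a k) = 0" ..
  show ?thesis
    using eventually_gt_at_top[of k]
  proof eventually_elim
    case (elim n)
    then have "(\<Prod>k<n. r (a k)) = 0" using k by (intro prod_zero) auto
    then show ?case by (simp only: powr_ge_zero)
  qed
next
  case False
  have pos: "r (a k) > 0" for k
    using False r a[of k] by (auto simp: prob_vector_def less_le)
  have r1: "(\<Sum>j = 0..m - 1. r j) = 1" using r by (simp add: prob_vector_def)
  have "(\<lambda>n. (\<Sum>k<n. ln (r (a k))) / real n) \<longlonglongrightarrow> (\<Sum>j = 0..m - 1. r j * ln (r j))"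
    by (rule typical_seq_average[OF l q1 r1 p a typical])
  moreover have "(\<Sum>j = 0..m - 1. r j * ln (r j)) < - (s * ln (real m))" using s by simp
  ultimately have "\<forall>\<^sub>F n in sequentially. (\<Sum>k<n. ln (r (a k))) / real n < - (s * ln (real m))"
    by (rule order_tendstoD)
  then show ?thesis using eventually_gt_at_top[of 0]
  proof eventually_elim
    case (elim n)
    then have "(\<Sum>k<n. ln (r (a k))) \<le> real n * - (s * ln (real m))"
      by (simp add: field_simps)
    then have "exp (\<Sum>k<n. ln (r (a k))) \<le> exp (real n * - (s * ln (real m)))" by simp
    also have "exp (\<Sum>k<n. ln (r (a k))) = (\<Prod>k<n. r (a k))" using pos by (simp add: exp_sum)
    also have "exp (real n * - (s * ln (real m))) = ((1 / real m) ^ n) powr s"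
      using m by (simp add: powr_def ln_realpow ln_div mult_ac)
    finally show ?case .
  qed
qed

section \<open>Prefixes and base expansions\<close>

text \<open>Horner's scheme: the integer whose base-\<open>m\<close> numeral consists of the first
  \<open>n\<close> digits, \<open>a 0\<close> being the most significant.\<close>

primrec prefix_value :: "nat \<Rightarrow> (nat \<Rightarrow> nat) \<Rightarrow> nat \<Rightarrow> nat" where
  "prefix_value m a 0 = 0"
| "prefix_value m a (Suc n) = m * prefix_value m a n + a n"

text \<open>Quotient and remainder modulo \<open>m\<close> recover the shorter prefix and the last
  digit.\<close>

lemma prefix_value_inject:
  assumes "\<And>j. a j < m" "\<And>j. b j < m" "prefix_value m a n = prefix_value m b n" "k < n"
  shows "a k = b k"
  using assms(3,4)
proof (induction n)
  case (Suc n)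
  have "prefix_value m a n = prefix_value m b n" "a n = b n"
    using arg_cong[OF Suc.prems(1), of "\<lambda>x. x div m"] arg_cong[OF Suc.prems(1), of "\<lambda>x. x mod m"]
      assms(1)[of n] assms(2)[of n] by simp_all
  with Suc show ?case by (cases "k = n") auto
qed simp

text \<open>The formula for a single digit in terms of consecutive floors is exactly the recursion
  of \<open>prefix_value\<close>. This translates between distances on the line and agreement of
  digits.\<close>

lemma floor_base_expansion:
  assumes m: "m > 1" and a: "is_base_expansion m x a"
  shows "\<lfloor>real m ^ n * x\<rfloor> = int (prefix_value m a n)"
proof (induction n)
  case 0
  have "real_of_int \<lfloor>real m ^ 0 * x\<rfloor> = 0"
    using base_expansion_partial_sum[OF m a, of 0] by simp
  then show ?case by simp
next
  case (Suc n)
  then show ?case using base_expansion_digit[OF m a, of n] by simp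
qed

lemma prefix_value_cong: "(\<And>k. k < n \<Longrightarrow> a k = b k) \<Longrightarrow> prefix_value m a n = prefix_value m b n"
  by (induction n) auto

lemma dist_le_of_same_prefix:
  assumes m: "m > 1" and "is_base_expansion m x a" "is_base_expansion m y b"
    and "\<And>k. k < n \<Longrightarrow> a k = b k"
  shows "dist x y \<le> (1 / real m) ^ n"
proof -
  have "\<lfloor>real m ^ n * x\<rfloor> = \<lfloor>real m ^ n * y\<rfloor>"
    using assms prefix_value_cong[of n a b m] by (simp add: floor_base_expansion)
  then have "\<bar>real m ^ n * x - real m ^ n * y\<bar> \<le> 1" by linarith
  then have "real m ^ n * \<bar>x - y\<bar> \<le> 1"
    by (simp add: right_diff_distrib[symmetric] abs_mult)
  then show ?thesis using m by (simp add: dist_real_def power_one_over field_simps)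
qed

lemma is_base_expansion_suminf:
  fixes m :: nat
  assumes m: "m > 1" and a: "\<And>j. a j \<in> {0..m - 1}" and "\<not> (\<exists>N. \<forall>j\<ge>N. a j = m - 1)"
  shows "is_base_expansion m (\<Sum>j. real (a j) / real m ^ Suc j) a"
proof -
  have "summable (\<lambda>j. real (a j) / real m ^ Suc j)"
  proof (rule summable_comparison_test')
    show "summable (\<lambda>j. (1 / real m) ^ j)" using m by (intro summable_geometric) simp
    fix j :: nat
    have "real (a j) \<le> real m" using a[of j] m by simp
    then show "norm (real (a j) / real m ^ Suc j) \<le> (1 / real m) ^ j"
      using m by (simp add: field_simps)
  qed
  then show ?thesis using assms by (auto simp: is_base_expansion_def summable_sums)
qed

lemma is_base_expansion_in_Ioo:
  assumes m: "m > 1" and a: "is_base_expansion m x a" and nz: "a j \<noteq> 0"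
  shows "x \<in> {0<..<1}"
proof -
  have "\<lfloor>x\<rfloor> = 0" using floor_base_expansion[OF m a, of 0] by simp
  then have "0 \<le> x" "x < 1" by linarith+
  moreover have "x \<noteq> 0" using base_expansion_digit[OF m a, of j] nz by auto
  ultimately show ?thesis by simp
qed

lemma base_digit_eqI:
  assumes "m > 1" "x \<in> {0<..<1}" "is_base_expansion m x a"
  shows "base_digit m x = a"
  using base_expansion_ex1[of m x] is_base_expansion_base_digit[of m x] assms by auto

section \<open>Covers and the upper bound\<close>

text \<open>A Borel-Cantelli argument for covers: the sets of all stages from \<open>N\<close> on
  cover \<open>E\<close>, and their total cost is at most a tail of the convergent series
  \<open>b\<close>, hence arbitrarily small.\<close>

lemma hausdorff_measure_eq_0I:
  fixes C :: "nat \<Rightarrow> 'i \<Rightarrow> 'a::metric_space set" and d b :: "nat \<Rightarrow> real"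
  assumes s: "s > 0" and fin: "\<And>n. finite (I n)"
    and bdd: "\<And>n i. bounded (C n i)" and diam: "\<And>n i. diameter (C n i) \<le> d n"
    and d: "d \<longlonglongrightarrow> 0" and b: "summable b"
    and le: "\<And>n. real (card (I n)) * d n powr s \<le> b n"
    and cov: "\<And>x. x \<in> E \<Longrightarrow> \<forall>\<^sub>F n in sequentially. \<exists>i\<in>I n. x \<in> C n i"
  shows "hausdorff_measure s E = 0"
proof -
  have "hausdorff_premeasure \<delta> s E \<le> ennreal e" if \<delta>: "\<delta> > 0" and e: "e > 0" for \<delta> e
  proof -
    have "\<forall>\<^sub>F n in sequentially. d n < \<delta>" using d \<delta> by (auto dest: order_tendstoD)
    then obtain N1 where N1: "\<And>n. n \<ge> N1 \<Longrightarrow> d n < \<delta>" by (auto simp: eventually_sequentially)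
    obtain N2 where N2: "\<And>n. n \<ge> N2 \<Longrightarrow> norm (\<Sum>i. b (i + n)) < e"
      using suminf_exist_split[OF e b] by blast
    \<comment> \<open>From stage \<open>N\<close> on, the diameters are below \<delta> and the tail
      of \<open>b\<close> is below \<open>e\<close>.\<close>
    define N where "N = max N1 N2"
    define f where "f n = (SOME f. bij_betw f {0..<card (I n)} (I n))" for n
    have f: "bij_betw (f n) {0..<card (I n)} (I n)" for n
      unfolding f_def using ex_bij_betw_nat_finite[OF fin] by (rule someI_ex)
    \<comment> \<open>Each finite stage is padded with empty sets, whose gauge is 0;
      \<open>prod_decode\<close> then lists the double family as the single sequence required of a
      cover.\<close>
    define V where "V n i = (if i < card (I (n + N)) then C (n + N) (f (n + N) i) else {})" for n i
    define U where "U k = case_prod V (prod_decode k)" for k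
    have "E \<subseteq> (\<Union>k. U k)"
    proof
      fix x assume "x \<in> E"
      then obtain N3 where N3: "\<And>n. n \<ge> N3 \<Longrightarrow> \<exists>i\<in>I n. x \<in> C n i"
        using cov by (force simp: eventually_sequentially)
      then obtain i where i: "i \<in> I (N3 + N)" "x \<in> C (N3 + N) i" by (metis le_add1)
      have "i \<in> f (N3 + N) ` {0..<card (I (N3 + N))}"
        using f[of "N3 + N"] i(1) by (simp add: bij_betw_def)
      then obtain j where j: "j < card (I (N3 + N))" "f (N3 + N) j = i" by auto
      have "x \<in> U (prod_encode (N3, j))" using i j by (simp add: U_def V_def)
      then show "x \<in> (\<Union>k. U k)" by blast
    qed
    moreover have "bounded (U k) \<and> diameter (U k) \<le> \<delta>" for k
    proof -
      obtain n i where k: "prod_decode k = (n, i)" by fastforce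
      have "N1 \<le> n + N" unfolding N_def by arith
      then have "d (n + N) < \<delta>" by (rule N1)
      then have "diameter (C (n + N) j) \<le> \<delta>" for j
        using diam[of "n + N" j] by linarith
      then show ?thesis using bdd \<delta> by (auto simp: U_def V_def k)
    qed
    ultimately have "U \<in> delta_covers \<delta> E" by (auto simp: delta_covers_def)
    then have "hausdorff_premeasure \<delta> s E \<le> (\<Sum>k. hausdorff_gauge s (U k))"
      unfolding hausdorff_premeasure_def by (rule INF_lower)
    also have "\<dots> = (\<Sum>k. (\<lambda>(n, i). hausdorff_gauge s (V n i)) (prod_decode k))"
      by (simp add: U_def split_beta)
    also have "\<dots> = (\<Sum>n. \<Sum>i. hausdorff_gauge s (V n i))"
      by (rule suminf_ennreal_2dimen) simp
    also have "\<dots> \<le> (\<Sum>n. ennreal (b (n + N)))"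
    proof (rule suminf_le)
      fix n
      have g: "hausdorff_gauge s (C n i) \<le> ennreal (d n powr s)" for n i
        using s diam[of n i] diameter_ge_0[OF bdd[of n i]]
        by (auto simp: hausdorff_gauge_def intro!: ennreal_leI powr_mono2)
      have "(\<Sum>i. hausdorff_gauge s (V n i)) = (\<Sum>i<card (I (n + N)). hausdorff_gauge s (V n i))"
        by (rule suminf_finite) (auto simp: V_def hausdorff_gauge_def)
      also have "\<dots> \<le> (\<Sum>i<card (I (n + N)). ennreal (d (n + N) powr s))"
        using g by (intro sum_mono) (simp add: V_def)
      also have "\<dots> = ennreal (real (card (I (n + N))) * d (n + N) powr s)"
        by (simp add: ennreal_mult ennreal_of_nat_eq_real_of_nat)
      also have "\<dots> \<le> ennreal (b (n + N))" by (intro ennreal_leI le)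
      finally show "(\<Sum>i. hausdorff_gauge s (V n i)) \<le> ennreal (b (n + N))" .
    qed auto
    also have "\<dots> = ennreal (\<Sum>n. b (n + N))"
    proof (rule suminf_ennreal2)
      show "0 \<le> b (i + N)" for i using le[of "i + N"] by (rule order_trans[rotated]) simp
      show "summable (\<lambda>i. b (i + N))" using b by (rule summable_ignore_initial_segment)
    qed
    also have "\<dots> \<le> ennreal e" using N2[of N] by (intro ennreal_leI) (simp add: N_def)
    finally show ?thesis .
  qed
  then have "hausdorff_premeasure \<delta> s E = 0" if "\<delta> > 0" for \<delta>
    using that by (intro antisym[OF ennreal_le_epsilon zero_le]) auto
  then show ?thesis unfolding hausdorff_measure_def by (simp add: image_constant_conv)
qed

text \<open>Lets a mass bound obtained with a positive exponent \<open>t\<close> be used for a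
  smaller \<open>s\<close>, including \<open>s = 0\<close>, where the gauge of a nonempty set is 1
  and the bound by 1 is what counts.\<close>

lemma hausdorff_gauge_antimono:
  assumes "0 \<le> s" "s \<le> t" "t > 0" "bounded U" "diameter U \<le> 1"
  shows "hausdorff_gauge t U \<le> hausdorff_gauge s U"
proof -
  have d: "0 \<le> diameter U" by (rule diameter_ge_0) fact
  have "diameter U powr t \<le> 1" using assms d by (simp add: powr_le1)
  moreover have "diameter U powr t \<le> diameter U powr s" if "s > 0"
  proof (cases "diameter U = 0")
    case False
    then show ?thesis using d assms by (intro powr_mono') auto
  qed simp
  ultimately show ?thesis using assms by (auto simp: hausdorff_gauge_def intro!: ennreal_leI)
qed

text \<open>Stage \<open>n\<close> of the cover consists of the cylinders of the words of length
  \<open>n\<close> with weight at least \<open>\<theta> ^ n\<close>. There are at most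
  \<open>exp (n * (H + 2 * \<eta>))\<close> of them, and each costs at most
  \<open>exp (- n * (H + 3 * \<eta>))\<close>.\<close>

lemma frequency_set_measure_eq_0:
  fixes m l :: nat and r :: "nat \<Rightarrow> real"
  assumes m: "m > 1" and l: "l \<ge> 1"
    and q1: "\<And>k. k \<ge> 1 \<Longrightarrow> q 1 k = k"
    and r: "prob_vector {0..m - 1} r"
    and p: "\<And>\<alpha>. \<alpha> \<in> words m l \<Longrightarrow> p \<alpha> = (\<Prod>i = 1..l. r (\<alpha> i))"
    and s: "s > 0" "- (\<Sum>j = 0..m - 1. r j * ln (r j)) < s * ln (real m)"
  shows "hausdorff_measure s (frequency_set m l q p) = 0"
proof -
  define H where "H = - (\<Sum>j = 0..m - 1. r j * ln (r j))"
  \<comment> \<open>A third of the gap: one share is lost to the total weight of \<open>v\<close>,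
    one to the lower bound on the weight of a prefix, and the last makes the costs summable.\<close>
  define \<eta> where "\<eta> = (s * ln (real m) - H) / 3"
  have \<eta>: "\<eta> > 0" using s by (simp add: \<eta>_def H_def)
  \<comment> \<open>Chosen so that the \<open>m\<close> shifted weights sum to
    \<open>exp \<eta>\<close>.\<close>
  define t where "t = (exp \<eta> - 1) / real m"
  have t: "t > 0" using \<eta> m by (simp add: t_def)
  define v where "v j = r j + t" for j
  have r0: "r j \<ge> 0" if "j \<in> {0..m - 1}" for j using r that by (auto simp: prob_vector_def)
  have r1: "(\<Sum>j = 0..m - 1. r j) = 1" using r by (simp add: prob_vector_def)
  have v: "v j > 0" if "j \<in> {0..m - 1}" for j using r0[OF that] t by (simp add: v_def)
  have sum_v: "(\<Sum>j = 0..m - 1. v j) = exp \<eta>"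
    using m r1 by (simp add: v_def sum.distrib t_def)
  have Hv: "(\<Sum>j = 0..m - 1. r j * ln (v j)) \<ge> - H"
  proof -
    have "r j * ln (r j) \<le> r j * ln (v j)" if "j \<in> {0..m - 1}" for j
    proof (cases "r j = 0")
      case False
      with r0[OF that] t have "ln (r j) \<le> ln (v j)" by (simp add: v_def)
      then show ?thesis using r0[OF that] by (rule mult_left_mono)
    qed simp
    then show ?thesis unfolding H_def minus_minus by (rule sum_mono)
  qed
  define \<theta> where "\<theta> = exp (- (H + \<eta>))"
  define I where "I n = {w \<in> {..<n} \<rightarrow>\<^sub>E {0..m - 1}. (\<Prod>k<n. v (w k)) \<ge> \<theta> ^ n}" for n
  define C where "C n w = {x \<in> {0<..<1}. \<forall>k<n. base_digit m x k = w k}" for n and w :: "nat \<Rightarrow> nat"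
  define d where "d n = (1 / real m) ^ n" for n
  have exps: "is_base_expansion m x (base_digit m x)" if "x \<in> {0<..<1}" for x
    using that by (intro is_base_expansion_base_digit m) auto
  show ?thesis
  proof (rule hausdorff_measure_eq_0I[where I = I and C = C and d = d and b = "\<lambda>n. exp (- \<eta>) ^ n"])
    show "finite (I n)" for n
      unfolding I_def by (rule finite_subset[OF _ finite_PiE[of "{..<n}" "\<lambda>_. {0..m - 1}"]]) auto
    show "bounded (C n w)" for n w
      by (rule bounded_subset[OF bounded_cbox[of 0 "1::real"]]) (auto simp: C_def)
    show "diameter (C n w) \<le> d n" for n w
      unfolding d_def by (rule diameter_le) (use dist_le_of_same_prefix[OF m exps exps, of _ _ n] in
          \<open>auto simp: C_def dist_norm\<close>)
    show "d \<longlonglongrightarrow> 0"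
      unfolding d_def using m by (intro LIMSEQ_power_zero) simp
    show "summable (\<lambda>n. exp (- \<eta>) ^ n)" using \<eta> by (intro summable_geometric) simp
    show "s > 0" by fact
    show "real (card (I n)) * d n powr s \<le> exp (- \<eta>) ^ n" for n
    proof -
      \<comment> \<open>Counting by weight: every word in \<open>I n\<close> weighs at least
        \<open>\<theta> ^ n\<close>, and all words of length \<open>n\<close> together weigh
        \<open>exp \<eta> ^ n\<close>.\<close>
      have "real (card (I n)) * \<theta> ^ n = (\<Sum>w\<in>I n. \<theta> ^ n)" by simp
      also have "\<dots> \<le> (\<Sum>w\<in>I n. \<Prod>k<n. v (w k))" by (rule sum_mono) (simp add: I_def)
      also have "\<dots> \<le> (\<Sum>w\<in>{..<n} \<rightarrow>\<^sub>E {0..m - 1}. \<Prod>k<n. v (w k))"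
      proof (rule sum_mono2)
        show "0 \<le> (\<Prod>k<n. v (w k))" if "w \<in> ({..<n} \<rightarrow>\<^sub>E {0..m - 1}) - I n" for w
          using that by (intro prod_nonneg ballI less_imp_le v) (auto simp: PiE_def Pi_def)
      qed (auto simp: I_def intro!: finite_PiE)
      also have "\<dots> = (\<Prod>k<n. \<Sum>j = 0..m - 1. v j)" by (rule prod_sum_PiE[symmetric]) auto
      also have "\<dots> = exp \<eta> ^ n" unfolding sum_v by simp
      finally have 1: "real (card (I n)) * \<theta> ^ n \<le> exp \<eta> ^ n" .
      have "d n powr s = exp (- (s * ln (real m))) ^ n"
        using m by (simp add: d_def powr_def ln_realpow ln_div flip: exp_of_nat_mult)
      also have "s * ln (real m) = H + \<eta> + 2 * \<eta>" by (simp add: \<eta>_def field_simps)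
      also have "exp (- (H + \<eta> + 2 * \<eta>)) = \<theta> * exp (- (2 * \<eta>))"
        by (simp add: \<theta>_def exp_add[symmetric])
      finally have "real (card (I n)) * d n powr s = (real (card (I n)) * \<theta> ^ n) * exp (- (2 * \<eta>)) ^ n"
        by (simp add: power_mult_distrib)
      also have "\<dots> \<le> exp \<eta> ^ n * exp (- (2 * \<eta>)) ^ n"
        by (intro mult_right_mono 1) simp
      also have "\<dots> = exp (- \<eta>) ^ n"
        by (simp add: power_mult_distrib[symmetric] exp_add[symmetric])
      finally show ?thesis .
    qed
    show "\<forall>\<^sub>F n in sequentially. \<exists>w\<in>I n. x \<in> C n w" if "x \<in> frequency_set m l q p" for x
    proof -
      define a where "a = base_digit m x"
      have x: "x \<in> {0<..<1}" and typical: "typical_seq m l q p a"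
        using that by (auto simp: frequency_set_eq a_def)
      have a: "a j \<in> {0..m - 1}" for j
        using exps[OF x] by (simp add: is_base_expansion_def a_def)
      have "(\<lambda>n. (\<Sum>k<n. ln (v (a k))) / real n) \<longlonglongrightarrow> (\<Sum>j = 0..m - 1. r j * ln (v j))"
        by (rule typical_seq_average[OF l q1 r1 p a typical])
      moreover have "- (H + \<eta>) < (\<Sum>j = 0..m - 1. r j * ln (v j))" using Hv \<eta> by linarith
      ultimately have "\<forall>\<^sub>F n in sequentially. - (H + \<eta>) < (\<Sum>k<n. ln (v (a k))) / real n"
        by (rule order_tendstoD)
      then show ?thesis using eventually_gt_at_top[of 0]
      proof eventually_elim
        case (elim n)
        then have "real n * (- (H + \<eta>)) \<le> (\<Sum>k<n. ln (v (a k)))"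
          by (simp add: field_simps)
        then have "exp (real n * (- (H + \<eta>))) \<le> exp (\<Sum>k<n. ln (v (a k)))" by simp
        then have "\<theta> ^ n \<le> (\<Prod>k<n. v (a k))"
          unfolding exp_of_nat_mult \<theta>_def using v[OF a] by (simp add: exp_sum)
        then have "restrict a {..<n} \<in> I n" using a by (auto simp: I_def)
        moreover have "x \<in> C n (restrict a {..<n})" using x by (simp add: C_def a_def)
        ultimately show ?case by blast
      qed
    qed
  qed
qed

section \<open>A law of large numbers for sparsely dependent events\<close>

text \<open>For \<open>n\<close> between consecutive squares, monotonicity encloses
  \<open>f n / n\<close> between averages at these squares, up to the ratio of the squares, which
  tends to 1.\<close>

lemma mono_average_tendsto_of_squares:
  fixes f :: "nat \<Rightarrow> real"
  assumes mono: "mono f" and f0: "\<And>n. f n \<ge> 0"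
    and lim: "(\<lambda>N. f (N\<^sup>2) / real (N\<^sup>2)) \<longlonglongrightarrow> c"
  shows "(\<lambda>n. f n / real n) \<longlonglongrightarrow> c"
proof -
  define a where "a N = f (N\<^sup>2) / real (N\<^sup>2)" for N
  have ratio: "(\<lambda>N. (real (Suc N) / real N)\<^sup>2) \<longlonglongrightarrow> 1\<^sup>2"
    by (intro tendsto_power LIMSEQ_Suc_n_over_n)
  have up: "(\<lambda>N. a (Suc N) * (real (Suc N) / real N)\<^sup>2) \<longlonglongrightarrow> c"
    using tendsto_mult[OF LIMSEQ_Suc[OF lim] ratio] by (simp add: a_def)
  have lo: "(\<lambda>N. a N / (real (Suc N) / real N)\<^sup>2) \<longlonglongrightarrow> c"
    using tendsto_divide[OF lim ratio] by (simp add: a_def)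
  \<comment> \<open>The bounds are sequences in \<open>N\<close>; substituting
    \<open>N = floor_sqrt n\<close>, which tends to infinity, makes them sequences in
    \<open>n\<close>.\<close>
  have fs: "filterlim floor_sqrt at_top sequentially"
    unfolding filterlim_at_top by (auto simp: eventually_sequentially le_floor_sqrt_iff)
  show ?thesis
  proof (rule tendsto_sandwich[OF _ _ filterlim_compose[OF lo fs] filterlim_compose[OF up fs]])
    show "\<forall>\<^sub>F n in sequentially. a (floor_sqrt n) / (real (Suc (floor_sqrt n)) / real (floor_sqrt n))\<^sup>2 \<le> f n / real n"
      using eventually_gt_at_top[of 0]
    proof eventually_elim
      case (elim n)
      define N where "N = floor_sqrt n"
      have N: "N > 0" "N\<^sup>2 \<le> n" "n \<le> (Suc N)\<^sup>2"
        using elim Suc_floor_sqrt_power2_gt[of n] by (auto simp: N_def)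
      have "a N / (real (Suc N) / real N)\<^sup>2 = f (N\<^sup>2) / real ((Suc N)\<^sup>2)"
        using N(1) by (simp add: a_def field_simps del: of_nat_Suc)
      also have "\<dots> \<le> f n / real n"
        using elim N f0 monoD[OF mono N(2)] by (intro frac_le) (simp_all del: of_nat_power)
      finally show ?case by (simp add: N_def)
    qed
    show "\<forall>\<^sub>F n in sequentially. f n / real n \<le> a (Suc (floor_sqrt n)) * (real (Suc (floor_sqrt n)) / real (floor_sqrt n))\<^sup>2"
      using eventually_gt_at_top[of 0]
    proof eventually_elim
      case (elim n)
      define N where "N = floor_sqrt n"
      have N: "N > 0" "N\<^sup>2 \<le> n" "n \<le> (Suc N)\<^sup>2"
        using elim Suc_floor_sqrt_power2_gt[of n] by (auto simp: N_def)
      have "f n / real n \<le> f ((Suc N)\<^sup>2) / real (N\<^sup>2)"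
        using elim N f0 monoD[OF mono N(3)] by (intro frac_le) (simp_all del: of_nat_power)
      also have "\<dots> = a (Suc N) * (real (Suc N) / real N)\<^sup>2"
        using N(1) by (simp add: a_def field_simps del: of_nat_Suc)
      finally show ?case by (simp add: N_def)
    qed
  qed
qed

text \<open>In each row of the covariance matrix at most \<open>L\<close> entries are nonzero, and
  each entry is at most 1, so the count has variance at most \<open>n * L\<close>. At the squares
  the variances of the averages are summable, and integrating the series of squared deviations shows
  that it converges almost surely.\<close>

lemma (in prob_space) AE_frequency_tendsto:
  fixes A :: "nat \<Rightarrow> 'a set" and c :: real and L :: nat
  assumes A: "\<And>k. A k \<in> events" and pA: "\<And>k. k \<ge> 1 \<Longrightarrow> prob (A k) = c"
    and dep: "\<And>k n. k \<ge> 1 \<Longrightarrow> card {j \<in> {1..n}. prob (A k \<inter> A j) \<noteq> c * c} \<le> L"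
  shows "AE \<omega> in M. (\<lambda>n. 1 / real n * real (card {k. 0 < k \<and> k \<le> n \<and> \<omega> \<in> A k})) \<longlonglongrightarrow> c"
proof -
  define f :: "nat \<Rightarrow> 'a \<Rightarrow> real" where "f n \<omega> = (\<Sum>k\<in>{1..n}. indicator (A k) \<omega>)" for n \<omega>
  have f_card: "f n \<omega> = real (card {k. 0 < k \<and> k \<le> n \<and> \<omega> \<in> A k})" for n \<omega>
  proof -
    have "f n \<omega> = real (card ({1..n} \<inter> {k. \<omega> \<in> A k}))"
      by (simp add: f_def indicator_def sum.If_cases)
    also have "{1..n} \<inter> {k. \<omega> \<in> A k} = {k. 0 < k \<and> k \<le> n \<and> \<omega> \<in> A k}" by auto
    finally show ?thesis .
  qed
  have [measurable]: "f n \<in> borel_measurable M" for n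
    unfolding f_def using A by measurable
  have c: "0 \<le> c" using pA[of 1] measure_nonneg[of M "A 1"] by simp
  let ?X = "\<lambda>k \<omega>. (indicator (A k) \<omega> - c :: real)"
  have [simp]: "integrable M (indicator (A k) :: 'a \<Rightarrow> real)" for k
    using A by (simp add: integrable_indicator_iff emeasure_eq_measure)
  have prodX: "?X k \<omega> * ?X j \<omega> = indicator (A k \<inter> A j) \<omega> - c * indicator (A k) \<omega> - c * indicator (A j) \<omega> + c * c"
    for k j \<omega> by (simp add: indicator_inter_arith algebra_simps)
  have intI: "integrable M (indicator (A k \<inter> A j) :: 'a \<Rightarrow> real)" for k j
    using A by (simp add: integrable_indicator_iff emeasure_eq_measure)
  have integrable: "integrable M (\<lambda>\<omega>. ?X k \<omega> * ?X j \<omega>)" for k j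
    unfolding prodX by (intro Bochner_Integration.integrable_add Bochner_Integration.integrable_diff
      integrable_mult_right intI) simp_all
  have cov: "expectation (\<lambda>\<omega>. ?X k \<omega> * ?X j \<omega>) = prob (A k \<inter> A j) - c * c" if "k \<ge> 1" "j \<ge> 1" for k j
    unfolding prodX using A intI pA[OF that(1)] pA[OF that(2)] by (simp add: prob_space)
  have square: "(f n \<omega> - real n * c)\<^sup>2 = (\<Sum>k\<in>{1..n}. \<Sum>j\<in>{1..n}. ?X k \<omega> * ?X j \<omega>)" for n \<omega>
  proof -
    have "f n \<omega> - real n * c = (\<Sum>k\<in>{1..n}. ?X k \<omega>)" by (simp add: f_def sum_subtractf)
    then show ?thesis by (simp add: power2_eq_square sum_product)
  qed
  have int_square: "integrable M (\<lambda>\<omega>. (f n \<omega> - real n * c)\<^sup>2)" for n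
    unfolding square by (intro Bochner_Integration.integrable_sum integrable)
  have second_moment: "expectation (\<lambda>\<omega>. (f n \<omega> - real n * c)\<^sup>2) \<le> real n * real L" for n
  proof -
    have "expectation (\<lambda>\<omega>. (f n \<omega> - real n * c)\<^sup>2)
        = (\<Sum>k\<in>{1..n}. \<Sum>j\<in>{1..n}. prob (A k \<inter> A j) - c * c)"
      unfolding square using integrable by (simp add: cov)
    also have "\<dots> \<le> (\<Sum>k\<in>{1..n}. real L)"
    proof (rule sum_mono)
      fix k assume k: "k \<in> {1..n}"
      have "(\<Sum>j\<in>{1..n}. prob (A k \<inter> A j) - c * c)
          \<le> (\<Sum>j\<in>{1..n}. if prob (A k \<inter> A j) \<noteq> c * c then 1 else 0)"
      proof (rule sum_mono)
        fix j
        have "prob (A k \<inter> A j) - c * c \<le> 1"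
          using prob_le_1[of "A k \<inter> A j"] mult_nonneg_nonneg[OF c c] by linarith
        then show "prob (A k \<inter> A j) - c * c \<le> (if prob (A k \<inter> A j) \<noteq> c * c then 1 else 0)" by simp
      qed
      also have "\<dots> = real (card {j \<in> {1..n}. prob (A k \<inter> A j) \<noteq> c * c})"
        by (simp add: sum.If_cases Int_def)
      also have "\<dots> \<le> real L" using dep[of k n] k by simp
      finally show "(\<Sum>j\<in>{1..n}. prob (A k \<inter> A j) - c * c) \<le> real L" .
    qed
    also have "\<dots> = real n * real L" by simp
    finally show ?thesis .
  qed
  \<comment> \<open>The squared deviation of the average at a square; \<open>Suc N\<close> avoids
    the average over no events.\<close>
  define g where "g N \<omega> = (f ((Suc N)\<^sup>2) \<omega> / real ((Suc N)\<^sup>2) - c)\<^sup>2" for N \<omega>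
  have [measurable]: "g N \<in> borel_measurable M" for N unfolding g_def by measurable
  have g_int: "(\<integral>\<^sup>+\<omega>. ennreal (g N \<omega>) \<partial>M) \<le> ennreal (real L * (1 / (real (Suc N))\<^sup>2))" for N
  proof -
    let ?n = "(Suc N)\<^sup>2"
    have n: "real ?n > 0" by simp
    have g: "g N \<omega> = (f ?n \<omega> - real ?n * c)\<^sup>2 / (real ?n)\<^sup>2" for \<omega>
    proof -
      have "f ?n \<omega> / real ?n - c = (f ?n \<omega> - real ?n * c) / real ?n"
        using n by (simp add: diff_divide_distrib del: of_nat_power of_nat_Suc)
      then show ?thesis by (simp only: g_def power_divide)
    qed
    have "(\<integral>\<^sup>+\<omega>. ennreal (g N \<omega>) \<partial>M) = ennreal (expectation (g N))"
      unfolding g using int_square[of ?n]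
      by (intro nn_integral_eq_integral integrable_divide AE_I2 divide_nonneg_nonneg zero_le_power2)
    also have "expectation (g N) = expectation (\<lambda>\<omega>. (f ?n \<omega> - real ?n * c)\<^sup>2) / (real ?n)\<^sup>2"
      unfolding g by simp
    also have "\<dots> \<le> (real ?n * real L) / (real ?n)\<^sup>2"
      by (intro divide_right_mono second_moment) simp
    also have "\<dots> = real L * (1 / real ?n)"
      using n by (simp add: power2_eq_square del: of_nat_power of_nat_Suc)
    finally show ?thesis by (simp add: ennreal_leI)
  qed
  have "summable (\<lambda>N. real L * (1 / (real (Suc N))\<^sup>2))"
    using inverse_squares_sums by (intro summable_mult) (auto simp: sums_iff)
  then have fin: "(\<Sum>N. ennreal (real L * (1 / (real (Suc N))\<^sup>2))) \<noteq> top"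
    by (subst suminf_ennreal2) auto
  \<comment> \<open>A series with finite expectation is finite almost everywhere, so its terms tend
    to 0 there.\<close>
  have "(\<integral>\<^sup>+\<omega>. (\<Sum>N. ennreal (g N \<omega>)) \<partial>M) = (\<Sum>N. \<integral>\<^sup>+\<omega>. ennreal (g N \<omega>) \<partial>M)"
    by (rule nn_integral_suminf) measurable
  also have "\<dots> \<le> (\<Sum>N. ennreal (real L * (1 / (real (Suc N))\<^sup>2)))"
    by (intro suminf_le g_int) auto
  finally have "(\<integral>\<^sup>+\<omega>. (\<Sum>N. ennreal (g N \<omega>)) \<partial>M) \<noteq> \<infinity>"
    using fin by (auto simp: top_unique)
  then have "AE \<omega> in M. (\<Sum>N. ennreal (g N \<omega>)) \<noteq> \<infinity>"
    by (intro nn_integral_PInf_AE) measurable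
  then show ?thesis
  proof eventually_elim
    case (elim \<omega>)
    have "summable (\<lambda>N. g N \<omega>)"
      using elim by (intro summable_suminf_not_top) (auto simp: g_def)
    then have "(\<lambda>N. g N \<omega>) \<longlonglongrightarrow> 0" by (rule summable_LIMSEQ_zero)
    then have "(\<lambda>N. sqrt (g N \<omega>)) \<longlonglongrightarrow> sqrt 0" by (rule tendsto_real_sqrt)
    then have "(\<lambda>N. f ((Suc N)\<^sup>2) \<omega> / real ((Suc N)\<^sup>2) - c) \<longlonglongrightarrow> 0"
      by (simp add: g_def tendsto_rabs_zero_iff)
    then have "(\<lambda>N. f ((Suc N)\<^sup>2) \<omega> / real ((Suc N)\<^sup>2)) \<longlonglongrightarrow> c" by (rule LIM_zero_cancel)
    then have "(\<lambda>N. f (N\<^sup>2) \<omega> / real (N\<^sup>2)) \<longlonglongrightarrow> c" by (rule LIMSEQ_imp_Suc)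
    then have "(\<lambda>n. f n \<omega> / real n) \<longlonglongrightarrow> c"
      by (rule mono_average_tendsto_of_squares[rotated 2])
        (auto simp: f_def mono_def intro!: sum_mono2 sum_nonneg)
    then show ?case by (simp add: f_card)
  qed
qed

section \<open>Bernoulli sequences\<close>

abbreviation bernoulli_seq :: "nat pmf \<Rightarrow> (nat \<Rightarrow> nat) measure" where
  "bernoulli_seq R \<equiv> Pi\<^sub>M UNIV (\<lambda>_. measure_pmf R)"

lemma prob_space_bernoulli_seq: "prob_space (bernoulli_seq R)"
  by (intro prob_space_PiM prob_space_measure_pmf)

lemma space_bernoulli_seq: "space (bernoulli_seq R) = UNIV"
  by (simp add: space_PiM PiE_UNIV_domain)

lemma cylinder_in_sets:
  assumes "finite S"
  shows "{\<omega>. \<forall>i\<in>S. \<omega> (f i) = w i} \<in> sets (bernoulli_seq R)"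
proof -
  have "{\<omega> \<in> space (bernoulli_seq R). \<forall>i\<in>S. \<omega> (f i) \<in> {w i}} \<in> sets (bernoulli_seq R)"
    using assms by (intro sets.sets_Collect_finite_All sets_Collect_single') auto
  then show ?thesis by (simp add: space_bernoulli_seq)
qed

text \<open>The constraints are indexed through an injective position map \<open>f\<close>, so that
  one formula covers a prefix, the word read at one time, and the words read at two times
  together.\<close>

lemma measure_cylinder:
  assumes S: "finite S" and f: "inj_on f S"
  shows "measure (bernoulli_seq R) {\<omega>. \<forall>i\<in>S. \<omega> (f i) = w i} = (\<Prod>i\<in>S. pmf R (w i))"
proof -
  interpret product_prob_space "\<lambda>_. measure_pmf R" "UNIV :: nat set"
    by unfold_locales
  have eq: "{\<omega>. \<forall>i\<in>S. \<omega> (f i) = w i} = prod_emb UNIV (\<lambda>_. measure_pmf R) (f ` S)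
      (\<Pi>\<^sub>E j\<in>f ` S. {w (inv_into S f j)})"
    using f by (auto simp: prod_emb_def PiE_iff)
  have "measure (bernoulli_seq R) {\<omega>. \<forall>i\<in>S. \<omega> (f i) = w i}
      = (\<Prod>j\<in>f ` S. measure (measure_pmf R) {w (inv_into S f j)})"
    unfolding eq using S by (intro measure_PiM_emb) auto
  also have "\<dots> = (\<Prod>i\<in>S. pmf R (w i))"
    using f by (simp add: prod.reindex pmf.rep_eq)
  finally show ?thesis .
qed

section \<open>Injectivity of the times and almost sure typicality\<close>

lemma admissible_times_strict_mono_index:
  assumes "admissible_times l q" "k \<ge> 1" "1 \<le> i" "i < j" "j \<le> l"
  shows "q i k < q j k"
proof -
  have step: "q (t - 1) k < q t k" if "t \<in> {2..l}" for t
    using assms(1,2) that unfolding admissible_times_def by blast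
  show ?thesis
    using assms(4,5)
  proof (induction j)
    case (Suc j)
    then have "q j k < q (Suc j) k" using step[of "Suc j"] assms(3) by simp
    with Suc.IH Suc.prems show ?case by (cases "i = j") auto
  qed simp
qed

lemma admissible_times_inj_on_index:
  assumes "admissible_times l q" "k \<ge> 1"
  shows "inj_on (\<lambda>i. q i k) {1..l}"
proof (rule inj_onI)
  fix i j assume "i \<in> {1..l}" "j \<in> {1..l}" "q i k = q j k"
  then show "i = j"
    using admissible_times_strict_mono_index[OF assms, of i j]
      admissible_times_strict_mono_index[OF assms, of j i]
    by (cases i j rule: linorder_cases) simp_all
qed

text \<open>The increment \<epsilon> is positive, so \<open>q i\<close> is strictly increasing. This
  limits how many times can share a digit with a given time.\<close>

lemma admissible_times_inj_on_time:
  assumes q: "admissible_times l q" and i: "i \<in> {1..l}"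
  shows "inj_on (q i) {1..}"
proof -
  have step: "q i n < q i (Suc n)" if "n \<ge> 1" for n
  proof -
    obtain \<epsilon> :: real where "\<epsilon> > 0"
      and "\<forall>n\<ge>1. \<forall>i\<in>{1..l}. real (q i (n + 1)) \<ge> real (q i n) + \<epsilon>"
      using q unfolding admissible_times_def by blast
    then have "\<epsilon> > 0" "real (q i (n + 1)) \<ge> real (q i n) + \<epsilon>"
      using i that by blast+
    then show ?thesis by simp
  qed
  have less: "q i a < q i b" if "1 \<le> a" "a < b" for a b
    using that(2)
  proof (induction b)
    case (Suc b)
    with that(1) step[of b] show ?case by (cases "a = b") simp_all
  qed simp
  show ?thesis
  proof (rule inj_onI)
    fix a b assume "a \<in> {1..}" "b \<in> {1..}" "q i a = q i b"
    then show "a = b" using less[of a b] less[of b a] by (cases a b rule: linorder_cases) simp_all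
  qed
qed

text \<open>The words read at times \<open>k\<close> and \<open>j\<close> are independent unless
  \<open>q i k = q i' j\<close> for some \<open>i\<close> and \<open>i'\<close>. Each pair
  \<open>(i, i')\<close> allows at most one such \<open>j\<close>, so at most \<open>l * l\<close>
  times depend on \<open>k\<close>.\<close>

lemma AE_typical_seq:
  assumes q: "admissible_times l q"
    and p: "\<And>\<alpha>. \<alpha> \<in> words m l \<Longrightarrow> p \<alpha> = (\<Prod>i = 1..l. pmf R (\<alpha> i))"
  shows "AE \<omega> in bernoulli_seq R. typical_seq m l q p \<omega>"
proof -
  interpret prob_space "bernoulli_seq R" by (rule prob_space_bernoulli_seq)
  have "AE \<omega> in bernoulli_seq R. (\<lambda>n. 1 / real n *
      real (card {k. 0 < k \<and> k \<le> n \<and> (\<lambda>i\<in>{1..l}. \<omega> (q i k)) = \<alpha>})) \<longlonglongrightarrow> p \<alpha>"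
    if \<alpha>: "\<alpha> \<in> words m l" for \<alpha>
  proof -
    define A where "A k = {\<omega>. \<forall>i\<in>{1..l}. \<omega> (q i k) = \<alpha> i}" for k
    have A: "(\<lambda>i\<in>{1..l}. \<omega> (q i k)) = \<alpha> \<longleftrightarrow> \<omega> \<in> A k" for \<omega> k
      using \<alpha> by (auto simp: A_def words_def PiE_def extensional_def fun_eq_iff)
    have prob_A: "prob (A k) = p \<alpha>" if "k \<ge> 1" for k
      unfolding A_def p[OF \<alpha>]
      using admissible_times_inj_on_index[OF q that] by (intro measure_cylinder) auto
    have indep: "prob (A k \<inter> A j) = p \<alpha> * p \<alpha>"
      if k: "k \<ge> 1" and j: "j \<ge> 1" and disj: "\<And>i i'. i \<in> {1..l} \<Longrightarrow> i' \<in> {1..l} \<Longrightarrow> q i k \<noteq> q i' j" for k j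
    proof (cases "l = 0")
      \<comment> \<open>For the empty word the disjointness condition is vacuous and does not give
        \<open>k \<noteq> j\<close>, but then both events are the whole space.\<close>
      case True
      then show ?thesis using prob_A[of 1] by (simp add: A_def p[OF \<alpha>] prob_space[unfolded space_bernoulli_seq])
    next
      case False
      then have "k \<noteq> j" using disj[of 1 1] by auto
      \<comment> \<open>Both words together form one cylinder indexed by pairs of a time and a
        letter position; disjointness across times and injectivity within a time make the positions
        distinct.\<close>
      have "A k \<inter> A j = {\<omega>. \<forall>(t, i)\<in>{k, j} \<times> {1..l}. \<omega> (q i t) = \<alpha> i}"
        by (auto simp: A_def)
      also have "\<dots> = {\<omega>. \<forall>x\<in>{k, j} \<times> {1..l}. \<omega> (q (snd x) (fst x)) = \<alpha> (snd x)}"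
        by (simp add: split_beta)
      also have "prob \<dots> = (\<Prod>x\<in>{k, j} \<times> {1..l}. pmf R (\<alpha> (snd x)))"
      proof (rule measure_cylinder)
        show "inj_on (\<lambda>x. q (snd x) (fst x)) ({k, j} \<times> {1..l})"
        proof (rule inj_onI)
          fix x y
          assume x: "x \<in> {k, j} \<times> {1..l}" and y: "y \<in> {k, j} \<times> {1..l}"
            and eq: "q (snd x) (fst x) = q (snd y) (fst y)"
          have i: "snd x \<in> {1..l}" "snd y \<in> {1..l}" and t: "fst x \<in> {k, j}" "fst y \<in> {k, j}"
            using x y by auto
          have "fst x = fst y"
            using disj[OF i] disj[OF i(2,1)] eq t by (metis insertE singletonD)
          moreover have "inj_on (\<lambda>i. q i (fst x)) {1..l}"
            using t(1) k j by (intro admissible_times_inj_on_index[OF q]) auto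
          then have "snd x = snd y"
            by (rule inj_onD[OF _ _ i]) (use eq \<open>fst x = fst y\<close> in simp)
          ultimately show "x = y" by (rule prod_eqI)
        qed
      qed simp
      also have "\<dots> = (\<Prod>t\<in>{k, j}. \<Prod>i\<in>{1..l}. pmf R (\<alpha> i))"
        by (subst prod.cartesian_product) (simp add: split_beta)
      also have "\<dots> = p \<alpha> * p \<alpha>" using \<open>k \<noteq> j\<close> by (simp add: p[OF \<alpha>])
      finally show ?thesis .
    qed
    have "AE \<omega> in bernoulli_seq R. (\<lambda>n. 1 / real n *
      real (card {k. 0 < k \<and> k \<le> n \<and> \<omega> \<in> A k})) \<longlonglongrightarrow> p \<alpha>"
    proof (rule AE_frequency_tendsto)
      show "A k \<in> events" for k unfolding A_def by (rule cylinder_in_sets) simp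
      show "prob (A k) = p \<alpha>" if "k \<ge> 1" for k using that by (rule prob_A)
      show "card {j \<in> {1..n}. prob (A k \<inter> A j) \<noteq> p \<alpha> * p \<alpha>} \<le> l * l" if k: "k \<ge> 1" for k n
      proof -
        \<comment> \<open>Every dependent \<open>j\<close> is recovered from a pair
          \<open>(i, i')\<close> by inverting \<open>q i'\<close>; the pairs with
          \<open>i = i'\<close> account for \<open>j = k\<close>.\<close>
        have "{j \<in> {1..n}. prob (A k \<inter> A j) \<noteq> p \<alpha> * p \<alpha>}
            \<subseteq> (\<lambda>(i, i'). inv_into {1..} (q i') (q i k)) ` ({1..l} \<times> {1..l})"
        proof
          fix j assume "j \<in> {j \<in> {1..n}. prob (A k \<inter> A j) \<noteq> p \<alpha> * p \<alpha>}"
          then have j: "j \<ge> 1" and "prob (A k \<inter> A j) \<noteq> p \<alpha> * p \<alpha>" by auto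
          then obtain i i' where i: "i \<in> {1..l}" "i' \<in> {1..l}" "q i k = q i' j"
            using indep[OF k j] by blast
          then have "j = inv_into {1..} (q i') (q i k)"
            using admissible_times_inj_on_time[OF q i(2)] j by simp
          then show "j \<in> (\<lambda>(i, i'). inv_into {1..} (q i') (q i k)) ` ({1..l} \<times> {1..l})"
            using i(1,2) by (intro rev_image_eqI[of "(i, i')"]) simp_all
        qed
        then have "card {j \<in> {1..n}. prob (A k \<inter> A j) \<noteq> p \<alpha> * p \<alpha>}
            \<le> card ((\<lambda>(i, i'). inv_into {1..} (q i') (q i k)) ` ({1..l} \<times> {1..l}))"
          by (intro card_mono) auto
        also have "\<dots> \<le> card ({1..l} \<times> {1..l})" by (intro card_image_le) simp
        finally show ?thesis by simp
      qed
    qed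
    then show ?thesis by (simp only: A)
  qed
  then show ?thesis
    unfolding typical_seq_def by (subst AE_finite_all[OF finite_words]) blast
qed

section \<open>The mass distribution principle and the lower bound\<close>

text \<open>Neither \<open>G\<close> nor \<open>X\<close> is assumed measurable, so preimages are
  bounded through measurable supersets \<open>W\<close>. The set \<open>B N\<close> collects
  outcomes for which the mass bound is uniform at small scales. If the Hausdorff measure were 0,
  every \<open>B N\<close> would be null, although they cover \<open>G\<close>.\<close>

lemma (in prob_space) mass_distribution_principle:
  fixes X :: "'a \<Rightarrow> 'b::metric_space" and K \<delta> s :: real
  assumes AE_G: "AE \<omega> in M. \<omega> \<in> G" and XE: "\<And>\<omega>. \<omega> \<in> G \<Longrightarrow> X \<omega> \<in> E"
    and B: "\<And>N. B N \<in> events" and GB: "G \<subseteq> (\<Union>N::nat. B N)" and K: "K > 0"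
    and W: "\<And>N. \<exists>\<delta>>0. \<forall>U. bounded U \<longrightarrow> diameter U \<le> \<delta> \<longrightarrow>
        (\<exists>W\<in>events. {\<omega> \<in> G \<inter> B N. X \<omega> \<in> U} \<subseteq> W \<and> emeasure M W \<le> ennreal K * hausdorff_gauge s U)"
  shows "hausdorff_measure s E \<noteq> 0"
proof
  assume zero: "hausdorff_measure s E = 0"
  have null: "emeasure M (B N) = 0" for N
  proof -
    obtain \<delta> where \<delta>: "\<delta> > 0" and W': "\<And>U. bounded U \<Longrightarrow> diameter U \<le> \<delta> \<Longrightarrow>
        \<exists>W\<in>events. {\<omega> \<in> G \<inter> B N. X \<omega> \<in> U} \<subseteq> W \<and> emeasure M W \<le> ennreal K * hausdorff_gauge s U"
      using W[of N] by blast
    have "emeasure M (B N) / ennreal K \<le> hausdorff_premeasure \<delta> s E"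
      unfolding hausdorff_premeasure_def
    proof (rule INF_greatest)
      fix U assume "U \<in> delta_covers \<delta> E"
      then have U: "E \<subseteq> (\<Union>i. U i)" "\<And>i. bounded (U i)" "\<And>i. diameter (U i) \<le> \<delta>"
        by (auto simp: delta_covers_def)
      have "\<forall>i. \<exists>W. W \<in> events \<and> {\<omega> \<in> G \<inter> B N. X \<omega> \<in> U i} \<subseteq> W \<and>
          emeasure M W \<le> ennreal K * hausdorff_gauge s (U i)"
        using W'[OF U(2,3)] by blast
      from choice[OF this] obtain V
        where V: "\<And>i. V i \<in> events" "\<And>i. {\<omega> \<in> G \<inter> B N. X \<omega> \<in> U i} \<subseteq> V i"
          "\<And>i. emeasure M (V i) \<le> ennreal K * hausdorff_gauge s (U i)" by auto
      have "emeasure M (B N) \<le> emeasure M (\<Union>i. V i)"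
      proof (rule emeasure_mono_AE)
        show "AE \<omega> in M. \<omega> \<in> B N \<longrightarrow> \<omega> \<in> (\<Union>i. V i)"
          using AE_G
        proof eventually_elim
          \<comment> \<open>Almost every outcome in \<open>B N\<close> lies in \<open>G\<close>, so
            its image is in \<open>E\<close> and hence in some \<open>U i\<close>.\<close>
          case (elim \<omega>)
          with XE[OF elim] U(1) obtain i where "X \<omega> \<in> U i" by blast
          with elim V(2)[of i] show ?case by blast
        qed
        show "(\<Union>i. V i) \<in> events" using V(1) by blast
      qed
      also have "\<dots> \<le> (\<Sum>i. emeasure M (V i))"
        using V(1) by (intro emeasure_subadditive_countably) auto
      also have "\<dots> \<le> (\<Sum>i. ennreal K * hausdorff_gauge s (U i))"
        by (intro suminf_le V(3)) auto
      also have "\<dots> = (\<Sum>i. hausdorff_gauge s (U i)) * ennreal K"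
        by (simp add: mult.commute)
      finally show "emeasure M (B N) / ennreal K \<le> (\<Sum>i. hausdorff_gauge s (U i))"
        using K by (intro divide_le_posI_ennreal) (simp_all add: mult.commute)
    qed
    also have "\<dots> \<le> hausdorff_measure s E"
      unfolding hausdorff_measure_def using \<delta> by (intro SUP_upper) simp
    finally show ?thesis using zero by (simp add: ennreal_divide_eq_0_iff)
  qed
  have "AE \<omega> in M. \<omega> \<notin> B N" for N
    using B null by (intro AE_not_in) auto
  then have "AE \<omega> in M. \<forall>N. \<omega> \<notin> B N" by (simp add: AE_all_countable)
  with AE_G have "AE \<omega> in M. False"
    by eventually_elim (use GB in blast)
  then show False by simp
qed

section \<open>Covering small sets by cylinders\<close>

lemma power_scale_exists:
  fixes b d :: real
  assumes b: "0 < b" "b < 1" and d: "0 < d" "d \<le> b ^ N"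
  obtains n where "n \<ge> N" "b ^ Suc n < d" "d \<le> b ^ n"
proof -
  define k where "k = (LEAST k. b ^ k < d)"
  have "\<exists>k. b ^ k < d" using real_arch_pow_inv[OF d(1) b(2)] .
  then have k: "b ^ k < d" unfolding k_def by (rule LeastI_ex)
  have "k > N"
  proof (rule ccontr)
    assume "\<not> k > N"
    then have "b ^ N \<le> b ^ k" using b by (intro power_decreasing) auto
    then show False using k d by linarith
  qed
  then obtain n where n: "k = Suc n" "n \<ge> N" by (cases k) auto
  have "\<not> b ^ n < d" using not_less_Least[of n "\<lambda>k. b ^ k < d"] n by (simp add: k_def)
  then show ?thesis using that n k by auto
qed

text \<open>The value \<open>\<lfloor>m\<^sup>n x\<rfloor>\<close> determines the first \<open>n\<close> digits, and on a set of diameter at most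
  \<open>m\<^sup>-\<^sup>n\<close> it differs from the value at a given point by at most one.\<close>

lemma three_cylinders_cover:
  fixes m n :: nat and X :: "(nat \<Rightarrow> nat) \<Rightarrow> real"
  assumes m: "m > 1"
    and X: "\<And>\<omega>. \<omega> \<in> Z \<Longrightarrow> is_base_expansion m (X \<omega>) \<omega>"
    and XU: "\<And>\<omega>. \<omega> \<in> Z \<Longrightarrow> X \<omega> \<in> U" and U: "bounded U" "diameter U \<le> (1 / real m) ^ n"
    and bound: "\<And>\<omega>. \<omega> \<in> Z \<Longrightarrow> (\<Prod>k<n. pmf R (\<omega> k)) \<le> c" and c: "c \<ge> 0"
  shows "\<exists>W\<in>sets (bernoulli_seq R). Z \<subseteq> W \<and> measure (bernoulli_seq R) W \<le> 3 * c"
proof (cases "Z = {}")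
  case True
  then show ?thesis using c by (intro bexI[of _ "{}"]) auto
next
  case False
  then obtain z where z: "z \<in> Z" by blast
  interpret prob_space "bernoulli_seq R" by (rule prob_space_bernoulli_seq)
  define P where "P \<omega> = int (prefix_value m \<omega> n)" for \<omega>
  \<comment> \<open>\<open>Y t\<close> collects the members of \<open>Z\<close> at integer offset
    \<open>t\<close> from the reference \<open>z\<close>. They share their first \<open>n\<close>
    digits, so the cylinder \<open>V t\<close> of any one of them contains all; taking a member of
    \<open>Z\<close> makes \<open>bound\<close> applicable.\<close>
  define Y where "Y t = {\<omega> \<in> Z. P \<omega> = P z + t}" for t
  define V where "V t = (if Y t = {} then {} else {\<omega>. \<forall>k\<in>{..<n}. \<omega> k = (SOME y. y \<in> Y t) k})" for t
  have digits: "\<omega> k < m" if "\<omega> \<in> Z" for \<omega> k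
  proof -
    have "\<omega> k \<le> m - 1" using X[OF that] by (simp add: is_base_expansion_def)
    then show ?thesis using m by linarith
  qed
  have V_sets: "V t \<in> events" for t
    unfolding V_def using cylinder_in_sets[of "{..<n}" "\<lambda>k. k"] by simp
  have Y_V: "Y t \<subseteq> V t" for t
  proof
    fix \<omega> assume \<omega>: "\<omega> \<in> Y t"
    define y where "y = (SOME y. y \<in> Y t)"
    have y: "y \<in> Y t" unfolding y_def some_in_eq using \<omega> by blast
    have "\<omega> k = y k" if "k < n" for k
      using \<omega> y that by (intro prefix_value_inject[of \<omega> m y n] digits) (auto simp: Y_def P_def)
    then show "\<omega> \<in> V t" using \<omega> by (auto simp: V_def y_def)
  qed
  have V_measure: "prob (V t) \<le> c" for t
  proof (cases "Y t = {}")
    case False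
    define y where "y = (SOME y. y \<in> Y t)"
    have y: "y \<in> Y t" unfolding y_def some_in_eq using False .
    have "prob (V t) = prob {\<omega>. \<forall>k\<in>{..<n}. \<omega> k = y k}" using False by (simp add: V_def y_def)
    also have "\<dots> = (\<Prod>k<n. pmf R (y k))" by (rule measure_cylinder) auto
    also have "\<dots> \<le> c" using y by (intro bound) (simp add: Y_def)
    finally show ?thesis .
  qed (simp add: V_def c)
  have "Z \<subseteq> V (- 1) \<union> V 0 \<union> V 1"
  proof
    fix \<omega> assume \<omega>: "\<omega> \<in> Z"
    have floor: "P \<omega> = \<lfloor>real m ^ n * X \<omega>\<rfloor>" if "\<omega> \<in> Z" for \<omega>
      unfolding P_def using floor_base_expansion[OF m X[OF that], of n] by simp
    have "\<bar>X \<omega> - X z\<bar> \<le> (1 / real m) ^ n"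
      using diameter_bounded_bound[OF U(1) XU[OF \<omega>] XU[OF z]] U(2) by (simp add: dist_real_def)
    then have "real m ^ n * \<bar>X \<omega> - X z\<bar> \<le> 1"
      using m by (simp add: power_one_over field_simps)
    then have "\<bar>real m ^ n * X \<omega> - real m ^ n * X z\<bar> \<le> 1"
      by (simp add: right_diff_distrib[symmetric] abs_mult)
    \<comment> \<open>Floors of reals at distance at most 1 differ by at most 1, which leaves three
      offsets.\<close>
    then have "P \<omega> - P z \<in> {- 1, 0, 1}"
      unfolding floor[OF \<omega>] floor[OF z] by (simp, linarith)
    then have "\<omega> \<in> Y (- 1) \<or> \<omega> \<in> Y 0 \<or> \<omega> \<in> Y 1" using \<omega> by (auto simp: Y_def)
    then show "\<omega> \<in> V (- 1) \<union> V 0 \<union> V 1" using Y_V by blast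
  qed
  moreover have "prob (V (- 1) \<union> V 0 \<union> V 1) \<le> 3 * c"
  proof -
    have "prob (V (- 1) \<union> V 0 \<union> V 1) \<le> prob (V (- 1) \<union> V 0) + prob (V 1)"
      by (intro measure_Un_le sets.Un V_sets)
    also have "prob (V (- 1) \<union> V 0) \<le> prob (V (- 1)) + prob (V 0)"
      by (intro measure_Un_le V_sets)
    finally show ?thesis using V_measure[of "- 1"] V_measure[of 0] V_measure[of 1] by linarith
  qed
  ultimately show ?thesis using V_sets by (intro bexI[of _ "V (- 1) \<union> V 0 \<union> V 1"]) auto
qed

text \<open>With \<open>n\<close> such that \<open>diameter U\<close> lies between \<open>m\<close>
  to the powers \<open>- (n + 1)\<close> and \<open>- n\<close>, three cylinders suffice, and
  replacing the scale by the diameter costs a factor \<open>m powr s\<close>.\<close>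

lemma gauge_cover:
  fixes m N :: nat and X :: "(nat \<Rightarrow> nat) \<Rightarrow> real"
  assumes m: "m > 1" and s: "s > 0"
    and X: "\<And>\<omega>. \<omega> \<in> Z \<Longrightarrow> is_base_expansion m (X \<omega>) \<omega>"
    and XU: "\<And>\<omega>. \<omega> \<in> Z \<Longrightarrow> X \<omega> \<in> U" and U: "bounded U" "diameter U \<le> (1 / real m) ^ N"
    and bound: "\<And>\<omega> n. \<omega> \<in> Z \<Longrightarrow> n \<ge> N \<Longrightarrow> (\<Prod>k<n. pmf R (\<omega> k)) \<le> ((1 / real m) ^ n) powr s"
  shows "\<exists>W\<in>sets (bernoulli_seq R). Z \<subseteq> W \<and>
    emeasure (bernoulli_seq R) W \<le> ennreal (3 * real m powr s) * hausdorff_gauge s U"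
proof -
  interpret prob_space "bernoulli_seq R" by (rule prob_space_bernoulli_seq)
  let ?b = "1 / real m"
  have b: "0 < ?b" "?b < 1" using m by simp_all
  have cover: "\<exists>W\<in>events. Z \<subseteq> W \<and> prob W \<le> 3 * ((?b ^ n) powr s)"
    if "n \<ge> N" "diameter U \<le> ?b ^ n" for n
    using that bound by (intro three_cylinders_cover[OF m X XU U(1)]) auto
  have d0: "diameter U \<ge> 0" by (rule diameter_ge_0[OF U(1)])
  consider "Z = {}" | "Z \<noteq> {}" "diameter U = 0" | "Z \<noteq> {}" "diameter U > 0"
    using d0 by fastforce
  then show ?thesis
  proof cases
    case 1
    then show ?thesis by (intro bexI[of _ "{}"]) auto
  next
    \<comment> \<open>A set of diameter 0 has gauge 0, since \<open>s > 0\<close>, and fits every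
      scale; the intersection of its covers at all scales is null.\<close>
    case 2
    have "\<forall>n. \<exists>W. W \<in> events \<and> Z \<subseteq> W \<and> prob W \<le> 3 * ((?b ^ (n + N)) powr s)"
    proof
      fix n
      have "diameter U \<le> ?b ^ (n + N)" using 2 b by simp
      with cover[of "n + N"] show "\<exists>W. W \<in> events \<and> Z \<subseteq> W \<and> prob W \<le> 3 * ((?b ^ (n + N)) powr s)"
        by (auto simp: Bex_def)
    qed
    from choice[OF this] obtain V where V: "\<And>n. V n \<in> events" "\<And>n. Z \<subseteq> V n"
        "\<And>n. prob (V n) \<le> 3 * ((?b ^ (n + N)) powr s)" by auto
    define W where "W = (\<Inter>n. V n)"
    have W: "W \<in> events" unfolding W_def using V(1) by blast
    have "prob W \<le> 3 * ((?b ^ (n + N)) powr s)" for n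
    proof -
      have "prob W \<le> prob (V n)" using V(1) by (intro finite_measure_mono) (auto simp: W_def)
      then show ?thesis using V(3) by (rule order_trans)
    qed
    moreover have "(\<lambda>n. 3 * ((?b ^ (n + N)) powr s)) \<longlonglongrightarrow> 0"
    proof -
      have "(\<lambda>n. ?b ^ n) \<longlonglongrightarrow> 0" using b by (intro LIMSEQ_power_zero) simp
      then have "(\<lambda>n. ?b ^ (n + N)) \<longlonglongrightarrow> 0" by (rule LIMSEQ_ignore_initial_segment)
      then have "(\<lambda>n. (?b ^ (n + N)) powr s) \<longlonglongrightarrow> 0 powr s"
        using s by (intro tendsto_powr' tendsto_const) auto
      then show ?thesis using s by (intro tendsto_mult_right_zero) simp
    qed
    ultimately have "prob W \<le> 0" by (intro LIMSEQ_le_const[where X = "\<lambda>n. 3 * ((?b ^ (n + N)) powr s)"]) auto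
    then have "emeasure (bernoulli_seq R) W = 0" by (simp add: emeasure_eq_measure measure_le_0_iff)
    then show ?thesis using W V(2) by (intro bexI[of _ W]) (auto simp: W_def)
  next
    case 3
    obtain n where n: "n \<ge> N" "?b ^ Suc n < diameter U" "diameter U \<le> ?b ^ n"
      using power_scale_exists[OF b 3(2) U(2)] .
    obtain W where W: "W \<in> events" "Z \<subseteq> W" "prob W \<le> 3 * ((?b ^ n) powr s)"
      using cover n by blast
    have "?b ^ n \<le> real m * diameter U" using n(2) m by (simp add: field_simps)
    then have "(?b ^ n) powr s \<le> (real m * diameter U) powr s"
      using s b by (intro powr_mono2) auto
    also have "\<dots> = real m powr s * diameter U powr s"
      using d0 by (simp add: powr_mult)
    finally have "prob W \<le> 3 * real m powr s * diameter U powr s" using W(3) by simp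
    then have "emeasure (bernoulli_seq R) W \<le> ennreal (3 * real m powr s * diameter U powr s)"
      by (simp add: emeasure_eq_measure ennreal_leI)
    also have "\<dots> = ennreal (3 * real m powr s) * ennreal (diameter U powr s)"
      by (rule ennreal_mult) auto
    also have "ennreal (diameter U powr s) = hausdorff_gauge s U"
      using 3(2) s by (auto simp: hausdorff_gauge_def)
    finally show ?thesis using W by blast
  qed
qed

section \<open>The random point and the lower bound\<close>

lemma pmf_of_prob_vector:
  fixes r :: "nat \<Rightarrow> real"
  assumes "prob_vector {0..m - 1} r"
  obtains R where "\<And>j. pmf R j = (if j \<in> {0..m - 1} then r j else 0)"
proof
  let ?f = "\<lambda>j. if j \<in> {0..m - 1} then r j else 0"
  have nonneg: "?f j \<ge> 0" for j using assms by (auto simp: prob_vector_def)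
  have "(\<integral>\<^sup>+j. ennreal (?f j) \<partial>count_space UNIV) = (\<Sum>j\<in>{0..m - 1}. ennreal (?f j))"
    by (rule nn_integral_count_space') (auto split: if_splits)
  also have "\<dots> = ennreal (\<Sum>j\<in>{0..m - 1}. ?f j)"
    by (intro sum_ennreal nonneg)
  also have "(\<Sum>j\<in>{0..m - 1}. ?f j) = 1"
    using assms by (simp add: prob_vector_def)
  finally show "pmf (embed_pmf ?f) j = ?f j" for j
    using nonneg by (intro pmf_embed_pmf) auto
qed

lemma frequency_set_measure_neq_0:
  fixes m l :: nat and r :: "nat \<Rightarrow> real"
  assumes m: "m > 1" and l: "l \<ge> 1" and q: "admissible_times l q"
    and q1: "\<And>k. k \<ge> 1 \<Longrightarrow> q 1 k = k"
    and r: "prob_vector {0..m - 1} r"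
    and p: "\<And>\<alpha>. \<alpha> \<in> words m l \<Longrightarrow> p \<alpha> = (\<Prod>i = 1..l. r (\<alpha> i))"
    and s: "s \<ge> 0" "s * ln (real m) < - (\<Sum>j = 0..m - 1. r j * ln (r j))"
  shows "hausdorff_measure s (frequency_set m l q p) \<noteq> 0"
proof -
  define H where "H = - (\<Sum>j = 0..m - 1. r j * ln (r j))"
  have lnm: "ln (real m) > 0" using m by simp
  have "s < H / ln (real m)" using s(2)[folded H_def] lnm by (simp add: pos_less_divide_eq)
  \<comment> \<open>The covering bound needs a positive exponent, while \<open>s\<close> may be 0.
    An exponent \<open>t\<close> strictly between \<open>s\<close> and the claimed dimension still
    satisfies the decay condition.\<close>
  then obtain t where t: "s < t" "t < H / ln (real m)" using dense by blast
  then have t0: "t > 0" and tH: "t * ln (real m) < H"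
    using s(1) lnm by (simp_all add: pos_less_divide_eq)
  have "s * ln (real m) \<ge> 0" using s(1) lnm by simp
  \<comment> \<open>Positive entropy excludes point masses, so typical sequences do not end in a
    constant digit.\<close>
  then have "H > 0" using s(2) unfolding H_def by linarith
  then have r_ne_1: "r j \<noteq> 1" if "j \<in> {0..m - 1}" for j
    using entropy_eq_0_of_point_mass[OF _ r that] by (auto simp: H_def)
  have r1: "(\<Sum>j = 0..m - 1. r j) = 1" using r by (simp add: prob_vector_def)
  obtain R where R: "\<And>j. pmf R j = (if j \<in> {0..m - 1} then r j else 0)"
    using pmf_of_prob_vector[OF r] by metis
  interpret prob_space "bernoulli_seq R" by (rule prob_space_bernoulli_seq)
  define G where "G = {\<omega>. (\<forall>j. \<omega> j \<in> {0..m - 1}) \<and> typical_seq m l q p \<omega>}"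
  define X :: "(nat \<Rightarrow> nat) \<Rightarrow> real" where "X \<omega> = (\<Sum>j. real (\<omega> j) / real m ^ Suc j)" for \<omega>
  \<comment> \<open>On \<open>B N\<close> the cylinder masses obey the decay from length
    \<open>N\<close> on; typical sequences satisfy it from some length on, so these sets exhaust
    \<open>G\<close>.\<close>
  define B where "B N = {\<omega> \<in> space (bernoulli_seq R). \<forall>n\<ge>N. (\<Prod>k<n. pmf R (\<omega> k)) \<le> ((1 / real m) ^ n) powr t}"
    for N :: nat
  have not_const: "\<not> (\<exists>N. \<forall>j\<ge>N. \<omega> j = c)" if "\<omega> \<in> G" "c \<in> {0..m - 1}" for \<omega> c
    using that r_ne_1 by (intro typical_seq_not_eventually_const[where q = q and p = p and r = r, OF l q1 r1 p]) (auto simp: G_def)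
  have expansion: "is_base_expansion m (X \<omega>) \<omega>" if "\<omega> \<in> G" for \<omega>
    unfolding X_def using that not_const[OF that, of "m - 1"]
    by (intro is_base_expansion_suminf m) (auto simp: G_def)
  show ?thesis
  proof (rule mass_distribution_principle[where G = G and B = B and X = X and K = "3 * real m powr t"])
    have "AE \<omega> in bernoulli_seq R. \<omega> j \<in> {0..m - 1}" for j
    proof -
      interpret product_prob_space "\<lambda>_. measure_pmf R" "UNIV :: nat set" by unfold_locales
      show ?thesis
        by (rule AE_component) (auto simp: AE_measure_pmf_iff set_pmf_eq R split: if_splits)
    qed
    then have "AE \<omega> in bernoulli_seq R. \<forall>j. \<omega> j \<in> {0..m - 1}" by (simp add: AE_all_countable)
    moreover have "AE \<omega> in bernoulli_seq R. typical_seq m l q p \<omega>"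
    proof (rule AE_typical_seq[OF q])
      fix \<alpha> assume \<alpha>: "\<alpha> \<in> words m l"
      then have "r (\<alpha> i) = pmf R (\<alpha> i)" if "i \<in> {1..l}" for i
        using that unfolding R words_def by (auto dest: PiE_mem)
      then show "p \<alpha> = (\<Prod>i = 1..l. pmf R (\<alpha> i))" using p[OF \<alpha>] by simp
    qed
    ultimately show "AE \<omega> in bernoulli_seq R. \<omega> \<in> G"
      by eventually_elim (simp add: G_def)
    show "X \<omega> \<in> frequency_set m l q p" if \<omega>: "\<omega> \<in> G" for \<omega>
    proof -
      obtain j where "\<omega> j \<noteq> 0" using not_const[OF \<omega>, of 0] by auto
      then have "X \<omega> \<in> {0<..<1}" by (rule is_base_expansion_in_Ioo[OF m expansion[OF \<omega>]])
      moreover from this have "base_digit m (X \<omega>) = \<omega>"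
        by (rule base_digit_eqI[OF m _ expansion[OF \<omega>]])
      ultimately show ?thesis using \<omega> by (simp add: frequency_set_eq G_def)
    qed
    show "B N \<in> events" for N
    proof -
      have [measurable]: "(\<lambda>\<omega>. pmf R (\<omega> k)) \<in> borel_measurable (bernoulli_seq R)" for k
        by (rule measurable_compose[of "\<lambda>\<omega>. \<omega> k" _ "measure_pmf R"]) simp_all
      show ?thesis unfolding B_def by measurable
    qed
    show "G \<subseteq> (\<Union>N. B N)"
    proof
      fix \<omega> assume \<omega>: "\<omega> \<in> G"
      then have "\<forall>\<^sub>F n in sequentially. (\<Prod>k<n. r (\<omega> k)) \<le> ((1 / real m) ^ n) powr t"
        using tH by (intro typical_seq_prod_decay[where q = q and p = p and r = r, OF m l q1 r p]) (auto simp: G_def H_def)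
      then obtain N where "\<And>n. n \<ge> N \<Longrightarrow> (\<Prod>k<n. r (\<omega> k)) \<le> ((1 / real m) ^ n) powr t"
        by (auto simp: eventually_sequentially)
      moreover have "pmf R (\<omega> k) = r (\<omega> k)" for k using \<omega> by (simp add: R G_def)
      ultimately have "\<omega> \<in> B N" by (simp add: B_def space_bernoulli_seq)
      then show "\<omega> \<in> (\<Union>N. B N)" by blast
    qed
    show "3 * real m powr t > 0" using m by simp
    show "\<exists>\<delta>>0. \<forall>U. bounded U \<longrightarrow> diameter U \<le> \<delta> \<longrightarrow>
        (\<exists>W\<in>events. {\<omega> \<in> G \<inter> B N. X \<omega> \<in> U} \<subseteq> W \<and>
          emeasure (bernoulli_seq R) W \<le> ennreal (3 * real m powr t) * hausdorff_gauge s U)" for N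
    \<comment> \<open>Sets of at most this diameter involve only cylinders of length at least
      \<open>N\<close>, where the decay on \<open>B N\<close> is in force.\<close>
    proof (intro exI[of _ "(1 / real m) ^ N"] conjI allI impI)
      show "(1 / real m) ^ N > 0" using m by simp
      fix U :: "real set" assume U: "bounded U" "diameter U \<le> (1 / real m) ^ N"
      have "\<exists>W\<in>events. {\<omega> \<in> G \<inter> B N. X \<omega> \<in> U} \<subseteq> W \<and>
          emeasure (bernoulli_seq R) W \<le> ennreal (3 * real m powr t) * hausdorff_gauge t U"
        by (rule gauge_cover[where X = X, OF m t0 _ _ U]) (use expansion in \<open>simp_all add: B_def\<close>)
      then obtain W where W: "W \<in> events" "{\<omega> \<in> G \<inter> B N. X \<omega> \<in> U} \<subseteq> W"
        "emeasure (bernoulli_seq R) W \<le> ennreal (3 * real m powr t) * hausdorff_gauge t U"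
        by blast
      have "(1 / real m) ^ N \<le> 1" using m by (intro power_le_one) auto
      then have "hausdorff_gauge t U \<le> hausdorff_gauge s U"
        using s(1) t(1) t0 U by (intro hausdorff_gauge_antimono) auto
      then have "ennreal (3 * real m powr t) * hausdorff_gauge t U
          \<le> ennreal (3 * real m powr t) * hausdorff_gauge s U"
        by (rule mult_left_mono) simp
      with W(3) have "emeasure (bernoulli_seq R) W \<le> ennreal (3 * real m powr t) * hausdorff_gauge s U"
        by (rule order_trans)
      then show "\<exists>W\<in>events. {\<omega> \<in> G \<inter> B N. X \<omega> \<in> U} \<subseteq> W \<and>
          emeasure (bernoulli_seq R) W \<le> ennreal (3 * real m powr t) * hausdorff_gauge s U"
        using W(1,2) by blast
    qed
  qed
qed

section \<open>Both bounds combined into the dimension formula\<close>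

theorem proposition2p5:
  fixes m l :: nat
    and q :: "nat \<Rightarrow> nat \<Rightarrow> nat"
    and p :: "(nat \<Rightarrow> nat) \<Rightarrow> real"
    and r :: "nat \<Rightarrow> real"
  assumes "m > 1" and "l \<ge> 1"
    and "admissible_times l q"
    and "\<And>k. k \<ge> 1 \<Longrightarrow> q 1 k = k"
    and "prob_vector (words m l) p"
    and "prob_vector {0..m - 1} r"
    and "\<And>\<alpha>. \<alpha> \<in> words m l \<Longrightarrow> p \<alpha> = (\<Prod>i = 1..l. r (\<alpha> i))"
  shows "hausdorff_dim (frequency_set m l q p) =
           ennreal (- (\<Sum>j = 0..m - 1. r j * ln (r j)) / ln (real m))"
proof -
  define H where "H = - (\<Sum>j = 0..m - 1. r j * ln (r j))"
  define D where "D = H / ln (real m)"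
  have lnm: "ln (real m) > 0" using assms(1) by simp
  have "H \<ge> 0" unfolding H_def by (rule entropy_nonneg) (use assms(6) in auto)
  then have D: "D \<ge> 0" using lnm by (simp add: D_def)
  have "hausdorff_dim (frequency_set m l q p) = ennreal D"
  proof (rule antisym)
    show "hausdorff_dim (frequency_set m l q p) \<le> ennreal D"
    proof (rule ennreal_le_epsilon)
      \<comment> \<open>The slack \<open>e\<close> also keeps the exponent \<open>D + e\<close>
        positive when the entropy is 0.\<close>
      fix e :: real assume e: "e > 0"
      have "H < (D + e) * ln (real m)" using lnm e by (simp add: D_def field_simps)
      then have "hausdorff_measure (D + e) (frequency_set m l q p) = 0"
        using D e by (intro frequency_set_measure_eq_0[where q = q and p = p and r = r, OF assms(1,2,4,6,7)]) (auto simp: H_def)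
      then have "hausdorff_dim (frequency_set m l q p) \<le> ennreal (D + e)"
        unfolding hausdorff_dim_def using D e
        by (intro Inf_lower CollectI exI[of _ "D + e"]) (simp del: ennreal_plus)
      then show "hausdorff_dim (frequency_set m l q p) \<le> ennreal D + ennreal e"
        using D e by simp
    qed
    show "ennreal D \<le> hausdorff_dim (frequency_set m l q p)"
      unfolding hausdorff_dim_def
    proof (rule Inf_greatest, clarify)
      fix s assume s: "0 \<le> s" "hausdorff_measure s (frequency_set m l q p) = 0"
      have "\<not> s * ln (real m) < H"
        using frequency_set_measure_neq_0[where q = q and p = p and r = r, OF assms(1-4,6,7) s(1)] s(2) by (auto simp: H_def)
      then show "ennreal D \<le> ennreal s"
        using lnm by (intro ennreal_leI) (simp add: D_def pos_divide_le_eq)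
    qed
  qed
  then show ?thesis by (simp add: D_def H_def)
qed

end
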